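(* Let $g:\mathbb{K}^n\to\mathbb{K}^n$ ($\mathbb{K}=\mathbb{R}$ or $\mathbb{C}$), and suppose the filtered Anderson acceleration (FAA) algorithm described in the context is run on $g$ with parameters $0<c_s<1$, $\bar\kappa>1$ and maximal depth $m\ge 1$ with $n\ge m$, from an initial iterate $x_0\in\mathbb{K}^n$ and with relaxation parameters $\beta_k$, all the differences $w_{k+1}-w_k$ which enter as columns being nonzero. Then at each iteration $k\ge 2$: (i) the matrix $F_k$ obtained after both filtering steps, that is, the matrix of the least-squares problem solved by the QR decomposition $F_k=Q_kR_k$ in step (5) of the algorithm, has Frobenius condition number at most $\bar\kappa$, and hence also $2$-norm condition number at most $\bar\kappa$; (ii) both filtering steps (the Length Filter and the Angle Filter) keep the first column of $F_k$, namely $w_{k+1}-w_k$.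
   Context: **Norms and condition numbers.** $\|\cdot\|$ is the Euclidean norm of a vector, $\|\cdot\|_F$ the Frobenius norm and $\|\cdot\|_2$ the spectral norm of a matrix. For an $n\times p$ matrix $F$ of full column rank with economy QR decomposition $F=QR$ ($Q$ is $n\times p$ with orthonormal columns, $R$ is $p\times p$ upper triangular), the Frobenius condition number is $\|F\|_F\|F^{-1}\|_F$ and the $2$-norm condition number is $\|F\|_2\|F^{-1}\|_2$, where $F^{-1}$ denotes the Moore–Penrose pseudoinverse, so that $\|F^{-1}\|_F=\|R^{-1}\|_F$ and $\|F^{-1}\|_2=\|R^{-1}\|_2$. **FAA algorithm.** Given iterates $x_k$, the residuals are $w_{k+1}=g(x_k)-x_k$. Parameters: $c_s$, $\bar\kappa$, $m$, initial iterate $x_0$, relaxation parameters $\beta_k$. Initialization: compute $w_1$ and set $x_1=x_0+\beta_0w_1$. Compute $w_2$, set $F_1=(w_2-w_1)$ and $E_1=(x_1-x_0)$ (one-column matrices), find $\gamma_2$ from $F_1^*F_1\gamma_2=F_1^*w_2$, set $m_1=1$ and $x_2=x_1+\beta_1w_2-(E_1+\beta_1F_1)\gamma_2$. For $k=2,3,\dots$: 1. Compute $w_{k+1}$. Set $m_k=\min\{m_{k-1}+1,m\}$, and if $m_{k-1}=m$ drop the last columns of $E_{k-1}$ and $F_{k-1}$. 2. Set $F_k=\big(\,w_{k+1}-w_k\ \ F_{k-1}\,\big)$ and $E_k=\big(\,x_k-x_{k-1}\ \ E_{k-1}\,\big)$ (the new column is placed first). 3. Replace $(E_k,F_k,m_k)$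 by the output of the Length Filter with inputs $E_k,F_k,m_k,c_s,\bar\kappa$. 4. Replace $(E_k,F_k,m_k)$ by the output of the Angle Filter with inputs $E_k,F_k,m_k,c_s$, which also returns the economy QR factors $Q_k,R_k$ of the resulting $F_k$. 5. Solve $R_k\gamma_{k+1}=Q_k^*w_{k+1}$. 6. Set $x_{k+1}=x_k+\beta_kw_{k+1}-(E_k+\beta_kF_k)\gamma_{k+1}$. **Length Filter** (inputs $E$, $F$ with columns $f_1,\dots,f_p$, the number $p$ of columns, $c_s$, $\bar\kappa$). Put $c_t=\sqrt{1-c_s^2}$ and $$b_1=\frac1{\|f_1\|^2},\qquad b_2=\frac1{c_s^2}\left\{\frac{c_t^2}{\|f_1\|^2}+\frac1{\|f_2\|^2}\right\},$$ $$b_j=\frac1{c_s^2}\left\{\frac{c_t^2(c_t+c_s)^{2(j-2)}}{\|f_1\|^2c_s^{2(j-2)}}+\sum_{i=2}^{j-1}\frac{c_t^2(c_t+c_s)^{2(j-i-1)}}{\|f_i\|^2c_s^{2(j-i)}}+\frac1{\|f_j\|^2}\right\},\quad 3\le j\le p.$$ For $l=p,p-1,\dots,1$ compute $C_F=\big(\sum_{j=1}^l\|f_j\|^2\big)\big(\sum_{j=1}^lb_j\big)$ and stop at the first (largest) $l$ for which $C_F\le\bar\kappa^2$. Return the first $l$ columns of $E$ and of $F$, and $l$ as the new number of columns. **Angle Filter** (inputs $E$, $F$ with columns $f_1,\dots,f_p$, the number $p$ of columns, $c_s$). Compute an economy QR decomposition $F=QR$ with $R=(r_{ij})$, and $\sigma_i=|r_{ii}|/\|f_i\|$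 for $i=2,\dots,p$ (this is the sine of the angle between $f_i$ and $\mathrm{span}\{f_1,\dots,f_{i-1}\}$ whenever $f_1,\dots,f_{i-1}$ are linearly independent; in general, take $\sigma_i$ to be that sine, i.e. $\|f_i\|^{-1}$ times the distance from $f_i$ to $\mathrm{span}\{f_1,\dots,f_{i-1}\}$). Simultaneously remove from $E$ and $F$ every column $i\in\{2,\dots,p\}$ with $\sigma_i<c_s$, update the number of columns, and, if any columns were removed, recompute the economy QR decomposition of the new $F$. Return $E,F,Q,R$ and the new number of columns. *)

theory Defs
  imports
    "HOL-Analysis.L2_Norm"
    "Jordan_Normal_Form.Schur_Decomposition"
    "Jordan_Normal_Form.DL_Rank"
begin

(* The scalar fields R and C: up to isometric isomorphism these are the only members of the
   class, since by Gelfand-Mazur they are the only real normed fields and the axiom then forces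
   the usual conjugation. *)
class real_or_complex = conjugatable_field + real_normed_field +
  assumes mult_conjugate: "x * conjugate x = (norm x)\<^sup>2 *\<^sub>R 1"

instance real :: real_or_complex
  by standard (simp add: power2_eq_square)

instance complex :: real_or_complex
  by standard (simp add: complex_norm_square[symmetric] scaleR_conv_of_real)


definition vec_norm :: "'k::real_normed_field vec \<Rightarrow> real" where
  "vec_norm v = L2_set (\<lambda>i. norm (v $ i)) {..<dim_vec v}"

definition frobenius_norm :: "'k::real_normed_field mat \<Rightarrow> real" where
  "frobenius_norm A = L2_set (\<lambda>ij. norm (A $$ ij)) ({..<dim_row A} \<times> {..<dim_col A})"

definition spectral_norm :: "'k::real_normed_field mat \<Rightarrow> real" where
  "spectral_norm A = (SUP v \<in> {v \<in> carrier_vec (dim_col A). vec_norm v \<le> 1}. vec_norm (A *\<^sub>v v))"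

(* Characterised by the four Penrose equations. *)
definition pseudoinverse :: "'k::conjugatable_field mat \<Rightarrow> 'k mat" where
  "pseudoinverse A = (THE X. X \<in> carrier_mat (dim_col A) (dim_row A)
     \<and> A * X * A = A \<and> X * A * X = X
     \<and> mat_adjoint (A * X) = A * X \<and> mat_adjoint (X * A) = X * A)"

definition frobenius_cond :: "'k::real_or_complex mat \<Rightarrow> real" where
  "frobenius_cond F = frobenius_norm F * frobenius_norm (pseudoinverse F)"

definition spectral_cond :: "'k::real_or_complex mat \<Rightarrow> real" where
  "spectral_cond F = spectral_norm F * spectral_norm (pseudoinverse F)"

definition economy_QR :: "'k::real_or_complex mat \<Rightarrow> 'k mat \<Rightarrow> 'k mat \<Rightarrow> bool" where
  "economy_QR F Q R \<longleftrightarrow>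
     Q \<in> carrier_mat (dim_row F) (dim_col F) \<and> mat_adjoint Q * Q = 1\<^sub>m (dim_col F)
     \<and> R \<in> carrier_mat (dim_col F) (dim_col F) \<and> upper_triangular R
     \<and> F = Q * R"


(* Columns are numbered from 0 here, as in the matrix library. *)
definition keep_cols :: "nat set \<Rightarrow> 'k mat \<Rightarrow> 'k mat" where
  "keep_cols I A = mat_of_cols (dim_row A) (nths (cols A) I)"

definition prepend_col :: "'k vec \<Rightarrow> 'k mat \<Rightarrow> 'k mat" where
  "prepend_col v A = mat_of_cols (dim_row A) (v # cols A)"

definition drop_last_col :: "'k mat \<Rightarrow> 'k mat" where
  "drop_last_col A = keep_cols {..<dim_col A - 1} A"

(* The filters below follow the usual mathematical numbering f_1, f_2, ... of the columns;
   f_i is col F (i - 1). *)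
definition col_norm :: "'k::real_normed_field mat \<Rightarrow> nat \<Rightarrow> real" where
  "col_norm F i = vec_norm (col F (i - 1))"

definition lf_b :: "real \<Rightarrow> 'k::real_normed_field mat \<Rightarrow> nat \<Rightarrow> real" where
  "lf_b cs F j = (let ct = sqrt (1 - cs\<^sup>2) in
     if j = 1 then 1 / (col_norm F 1)\<^sup>2
     else if j = 2 then 1 / cs\<^sup>2 * (ct\<^sup>2 / (col_norm F 1)\<^sup>2 + 1 / (col_norm F 2)\<^sup>2)
     else 1 / cs\<^sup>2 *
       (ct\<^sup>2 * (ct + cs) ^ (2 * (j - 2)) / ((col_norm F 1)\<^sup>2 * cs ^ (2 * (j - 2)))
        + (\<Sum>i = 2..j - 1. ct\<^sup>2 * (ct + cs) ^ (2 * (j - i - 1))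
                          / ((col_norm F i)\<^sup>2 * cs ^ (2 * (j - i))))
        + 1 / (col_norm F j)\<^sup>2))"

definition lf_CF :: "real \<Rightarrow> 'k::real_normed_field mat \<Rightarrow> nat \<Rightarrow> real" where
  "lf_CF cs F l = (\<Sum>j = 1..l. (col_norm F j)\<^sup>2) * (\<Sum>j = 1..l. lf_b cs F j)"

(* The downward search l = p, p - 1, ..., 1.  The value 0 means that no l passes the test. *)
fun lf_search :: "real \<Rightarrow> real \<Rightarrow> 'k::real_normed_field mat \<Rightarrow> nat \<Rightarrow> nat" where
  "lf_search cs \<kappa> F 0 = 0"
| "lf_search cs \<kappa> F (Suc l) =
     (if lf_CF cs F (Suc l) \<le> \<kappa>\<^sup>2 then Suc l else lf_search cs \<kappa> F l)"

definition length_filter ::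
  "real \<Rightarrow> real \<Rightarrow> 'k::real_normed_field mat \<Rightarrow> 'k mat \<Rightarrow> nat \<Rightarrow> 'k mat \<times> 'k mat \<times> nat" where
  "length_filter cs \<kappa> E F p = (let l = lf_search cs \<kappa> F p in
     (keep_cols {..<l} E, keep_cols {..<l} F, l))"

(* The sine of the angle between f_i and span {f_1, ..., f_(i-1)}, as a normalised distance;
   it equals |r_ii| / ||f_i|| whenever f_1, ..., f_(i-1) are linearly independent. *)
definition af_sine :: "'k::real_normed_field mat \<Rightarrow> nat \<Rightarrow> real" where
  "af_sine F i =
     (INF v \<in> vec_space.col_space (dim_row F) (keep_cols {..<i - 1} F).
        vec_norm (col F (i - 1) - v)) / col_norm F i"

definition angle_filter ::
  "real \<Rightarrow> 'k::real_normed_field mat \<Rightarrow> 'k mat \<Rightarrow> nat \<Rightarrow> 'k mat \<times> 'k mat \<times> nat" where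
  "angle_filter cs E F p = (
     let removed = {i \<in> {2..p}. af_sine F i < cs};
         kept = {i. i < p \<and> i + 1 \<notin> removed}
     in (keep_cols kept E, keep_cols kept F, card kept))"


(* The data produced by a run, indexed by the iteration number k: (E_new, F_new, m_new) enter
   the Length Filter, (E_len, F_len, m_len) leave it, and (E_out, F_out, m_out) leave the
   Angle Filter together with the factors Q_out, R_out; coeff k is gamma_k. *)
record 'k faa_trace =
  iterate :: "nat \<Rightarrow> 'k vec"
  resid :: "nat \<Rightarrow> 'k vec"
  coeff :: "nat \<Rightarrow> 'k vec"
  E_new :: "nat \<Rightarrow> 'k mat"
  F_new :: "nat \<Rightarrow> 'k mat"
  m_new :: "nat \<Rightarrow> nat"
  E_len :: "nat \<Rightarrow> 'k mat"
  F_len :: "nat \<Rightarrow> 'k mat"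
  m_len :: "nat \<Rightarrow> nat"
  E_out :: "nat \<Rightarrow> 'k mat"
  F_out :: "nat \<Rightarrow> 'k mat"
  m_out :: "nat \<Rightarrow> nat"
  Q_out :: "nat \<Rightarrow> 'k mat"
  R_out :: "nat \<Rightarrow> 'k mat"

definition faa_init ::
  "nat \<Rightarrow> 'k::real_or_complex vec \<Rightarrow> (nat \<Rightarrow> 'k) \<Rightarrow> 'k faa_trace \<Rightarrow> bool" where
  "faa_init n x0 \<beta> T \<longleftrightarrow>
     iterate T 0 = x0
     \<and> iterate T 1 = x0 + \<beta> 0 \<cdot>\<^sub>v resid T 1
     \<and> F_out T 1 = mat_of_cols n [resid T 2 - resid T 1]
     \<and> E_out T 1 = mat_of_cols n [iterate T 1 - iterate T 0]
     \<and> m_out T 1 = 1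
     \<and> coeff T 2 \<in> carrier_vec 1
     \<and> (mat_adjoint (F_out T 1) * F_out T 1) *\<^sub>v coeff T 2 = mat_adjoint (F_out T 1) *\<^sub>v resid T 2
     \<and> iterate T 2 =
         iterate T 1 + \<beta> 1 \<cdot>\<^sub>v resid T 2 - (E_out T 1 + \<beta> 1 \<cdot>\<^sub>m F_out T 1) *\<^sub>v coeff T 2"

definition faa_step ::
  "real \<Rightarrow> real \<Rightarrow> nat \<Rightarrow> (nat \<Rightarrow> 'k::real_or_complex) \<Rightarrow> 'k faa_trace \<Rightarrow> nat \<Rightarrow> bool" where
  "faa_step cs \<kappa> m \<beta> T k \<longleftrightarrow>
     (let trunc = (if m_out T (k - 1) = m then drop_last_col else id) in
        m_new T k = min (m_out T (k - 1) + 1) m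
        \<and> F_new T k = prepend_col (resid T (k + 1) - resid T k) (trunc (F_out T (k - 1)))
        \<and> E_new T k = prepend_col (iterate T k - iterate T (k - 1)) (trunc (E_out T (k - 1))))
     \<and> (E_len T k, F_len T k, m_len T k) = length_filter cs \<kappa> (E_new T k) (F_new T k) (m_new T k)
     \<and> (E_out T k, F_out T k, m_out T k) = angle_filter cs (E_len T k) (F_len T k) (m_len T k)
     \<and> economy_QR (F_out T k) (Q_out T k) (R_out T k)
     \<and> coeff T (k + 1) \<in> carrier_vec (m_out T k)
     \<and> R_out T k *\<^sub>v coeff T (k + 1) = mat_adjoint (Q_out T k) *\<^sub>v resid T (k + 1)
     \<and> iterate T (k + 1) =
         iterate T k + \<beta> k \<cdot>\<^sub>v resid T (k + 1)
           - (E_out T k + \<beta> k \<cdot>\<^sub>m F_out T k) *\<^sub>v coeff T (k + 1)"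

(* T records a run of FAA on g through iteration N.  An infinite run is a T that satisfies
   this for every N. *)
definition faa_run ::
  "nat \<Rightarrow> ('k::real_or_complex vec \<Rightarrow> 'k vec) \<Rightarrow> real \<Rightarrow> real \<Rightarrow> nat \<Rightarrow> 'k vec
     \<Rightarrow> (nat \<Rightarrow> 'k) \<Rightarrow> nat \<Rightarrow> 'k faa_trace \<Rightarrow> bool" where
  "faa_run n g cs \<kappa> m x0 \<beta> N T \<longleftrightarrow>
     (\<forall>k \<le> N. resid T (k + 1) = g (iterate T k) - iterate T k)
     \<and> faa_init n x0 \<beta> T
     \<and> (\<forall>k \<in> {2..N}. faa_step cs \<kappa> m \<beta> T k)"

end

theory Submission
  imports Defs "Jordan_Normal_Form.DL_Missing_Sublist"
begin

text \<open>Let \<open>F = QR\<close> be the filtered matrix and \<open>S\<close> the inverse of \<open>R\<close>, so that the pseudoinverse of \<open>F\<close> is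
  \<open>S Q*\<close> and has the Frobenius norm of \<open>S\<close>.  The Angle Filter guarantees
  \<open>|r_jj| \<ge> c_s \<parallel>f_j\<parallel>\<close> and \<open>|r_11| = \<parallel>f_1\<parallel>\<close>, hence \<open>|r_kj| \<le> c_t \<parallel>f_j\<parallel>\<close>
  above the diagonal.  Reading \<open>S R = 1\<close> along a row gives
  \<open>|s_ij| \<le> t (|s_ii| + \<dots> + |s_i,j-1|)\<close> with \<open>t = c_t / c_s\<close>, whence
  \<open>|s_ij| \<le> t (1 + t)^(j-i-1) |s_ii|\<close>.  The squares of these bounds, summed over column \<open>j\<close>, are exactly \<open>b_j\<close>.
  Removing columns only decreases the distances \<open>j - i\<close> and enlarges the angles, so the bound that the
  Length Filter checks on all columns persists for the columns that the Angle Filter keeps.  The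
  first column survives because \<open>C_F = 1\<close> for \<open>l = 1\<close>.\<close>

section \<open>Norms and adjoints\<close>

text \<open>The class axiom speaks only of the product of x and its conjugate; taking norms in it
  gives |x| |conjugate x| = |x|^2, and |x| cancels.\<close>

lemma norm_conjugate [simp]: "norm (conjugate x) = norm (x :: 'k::real_or_complex)"
proof (cases "x = 0")
  case False
  have "norm x * norm (conjugate x) = norm x * norm x"
    using arg_cong[OF mult_conjugate[of x], of norm]
    by (simp add: norm_mult power2_eq_square)
  with False show ?thesis by simp
qed simp

lemma mult_conjugate_of_real: "x * conjugate x = of_real ((norm x)\<^sup>2)"
  for x :: "'k::real_or_complex"
  by (simp add: mult_conjugate of_real_def)

text \<open>\<open>conjugate 1\<close> is idempotent because 1 * 1 = 1, and it is nonzero, so it is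
  1.\<close>

lemma conjugate_one [simp]: "conjugate 1 = (1 :: 'k::conjugatable_field)"
  using conjugate_dist_mul[of "1 :: 'k" "1 :: 'k"] conjugate_zero_iff[of "1 :: 'k"]
  by (simp del: conjugate_zero_iff)

lemma dim_mat_adjoint [simp]:
  "dim_row (mat_adjoint A) = dim_col A" "dim_col (mat_adjoint A) = dim_row A"
  by (simp_all add: mat_adjoint_def)

lemma mat_adjoint_carrier [simp]:
  "mat_adjoint A \<in> carrier_mat m n \<longleftrightarrow> A \<in> carrier_mat n m"
  unfolding carrier_mat_def by (simp add: conj_commute)

lemma index_mat_adjoint [simp]:
  "i < dim_col A \<Longrightarrow> j < dim_row A \<Longrightarrow> mat_adjoint A $$ (i, j) = conjugate (A $$ (j, i))"
  by (simp add: mat_adjoint_def mat_of_rows_def)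

lemma mat_adjoint_adjoint [simp]: "mat_adjoint (mat_adjoint A) = A"
  by (rule eq_matI) simp_all

lemma mat_adjoint_one [simp]: "mat_adjoint (1\<^sub>m n :: 'k::conjugatable_field mat) = 1\<^sub>m n"
  by (rule eq_matI) simp_all

lemma mat_adjoint_mult:
  "dim_col A = dim_row B \<Longrightarrow> mat_adjoint (A * B) = mat_adjoint B * mat_adjoint A"
  by (rule eq_matI)
    (simp_all add: scalar_prod_def sum_conjugate conjugate_dist_mul mult.commute)

section \<open>Euclidean norm and isometries\<close>

lemma vec_norm_nonneg [simp]: "0 \<le> vec_norm v"
  by (simp add: vec_norm_def)

lemma vec_norm_sq: "(vec_norm v)\<^sup>2 = (\<Sum>i<dim_vec v. (norm (v $ i))\<^sup>2)"
  by (simp add: vec_norm_def L2_set_def sum_nonneg)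

lemma vec_norm_pos: "v \<in> carrier_vec n \<Longrightarrow> v \<noteq> 0\<^sub>v n \<Longrightarrow> 0 < vec_norm v"
  by (force simp: vec_norm_def L2_set_eq_0_iff less_le)

lemma vec_norm_conj_scalar_prod:
  "v \<bullet>c v = of_real ((vec_norm v)\<^sup>2)" for v :: "'k::real_or_complex vec"
  by (simp add: vec_norm_sq scalar_prod_def mult_conjugate_of_real atLeast0LessThan
      del: of_real_power)

lemma conj_scalar_prod_adjoint:
  assumes "A \<in> carrier_mat m n" "v \<in> carrier_vec n" "w \<in> carrier_vec m"
  shows "(A *\<^sub>v v) \<bullet>c w = v \<bullet>c (mat_adjoint A *\<^sub>v w)"
proof -
  have "(A *\<^sub>v v) \<bullet>c w = (\<Sum>i = 0..<m. \<Sum>j = 0..<n. A $$ (i, j) * v $ j * conjugate (w $ i))"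
    using assms by (simp add: scalar_prod_def sum_distrib_right)
  also have "\<dots> = (\<Sum>j = 0..<n. \<Sum>i = 0..<m. A $$ (i, j) * v $ j * conjugate (w $ i))"
    by (rule sum.swap)
  also have "\<dots> = v \<bullet>c (mat_adjoint A *\<^sub>v w)"
    using assms
    by (simp add: scalar_prod_def sum_distrib_left sum_conjugate conjugate_dist_mul mult_ac)
  finally show ?thesis .
qed

text \<open>Moving \<open>Q\<close> across the inner product turns <Qv, Qv> into <v, Q^H Q v> = <v,
  v>.\<close>

lemma vec_norm_isometry:
  fixes Q :: "'k::real_or_complex mat"
  assumes Q: "Q \<in> carrier_mat n p" "mat_adjoint Q * Q = 1\<^sub>m p" and v: "v \<in> carrier_vec p"
  shows "vec_norm (Q *\<^sub>v v) = vec_norm v"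
proof -
  have "(Q *\<^sub>v v) \<bullet>c (Q *\<^sub>v v) = v \<bullet>c (mat_adjoint Q *\<^sub>v (Q *\<^sub>v v))"
    using Q v by (intro conj_scalar_prod_adjoint) auto
  also have "mat_adjoint Q *\<^sub>v (Q *\<^sub>v v) = v"
    using Q v by (subst assoc_mult_mat_vec[symmetric, of _ p n]) auto
  finally have "(vec_norm (Q *\<^sub>v v))\<^sup>2 = (vec_norm v)\<^sup>2"
    unfolding vec_norm_conj_scalar_prod of_real_eq_iff .
  thus ?thesis by (simp add: power2_eq_iff_nonneg)
qed

section \<open>Frobenius and spectral norms\<close>

lemma frobenius_norm_nonneg [simp]: "0 \<le> frobenius_norm A"
  by (simp add: frobenius_norm_def)

lemma frobenius_norm_sq:
  "(frobenius_norm A)\<^sup>2 = (\<Sum>i<dim_row A. \<Sum>j<dim_col A. (norm (A $$ (i, j)))\<^sup>2)"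
  by (simp add: frobenius_norm_def L2_set_def sum_nonneg sum.cartesian_product)

lemma frobenius_norm_sq_cols:
  "(frobenius_norm A)\<^sup>2 = (\<Sum>j<dim_col A. (vec_norm (col A j))\<^sup>2)"
  unfolding frobenius_norm_sq by (subst sum.swap) (simp add: vec_norm_sq)

lemma frobenius_norm_adjoint [simp]:
  "frobenius_norm (mat_adjoint A) = frobenius_norm A" for A :: "'k::real_or_complex mat"
proof -
  have "(frobenius_norm (mat_adjoint A))\<^sup>2 = (frobenius_norm A)\<^sup>2"
    unfolding frobenius_norm_sq by (subst sum.swap) simp
  thus ?thesis by (simp add: power2_eq_iff_nonneg)
qed

lemma frobenius_norm_isometry:
  fixes Q :: "'k::real_or_complex mat"
  assumes "Q \<in> carrier_mat n p" "mat_adjoint Q * Q = 1\<^sub>m p" "A \<in> carrier_mat p q"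
  shows "frobenius_norm (Q * A) = frobenius_norm A"
proof -
  have "(frobenius_norm (Q * A))\<^sup>2 = (frobenius_norm A)\<^sup>2"
    unfolding frobenius_norm_sq_cols
  proof (rule sum.cong)
    fix j assume "j \<in> {..<dim_col A}"
    hence "vec_norm (col (Q * A) j) = vec_norm (Q *\<^sub>v col A j)"
      using assms by (subst col_mult2[OF assms(1,3)]) auto
    thus "(vec_norm (col (Q * A) j))\<^sup>2 = (vec_norm (col A j))\<^sup>2"
      using vec_norm_isometry[OF assms(1,2) col_carrier_vec[OF _ assms(3)]] \<open>j \<in> _\<close> assms(3)
      by simp
  qed simp
  thus ?thesis by (simp add: power2_eq_iff_nonneg)
qed

text \<open>Cauchy-Schwarz on every row of \<open>A\<close>, then summation of the squares over the
  rows.\<close>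

lemma vec_norm_mult_mat_vec_le:
  assumes v: "v \<in> carrier_vec (dim_col A)"
  shows "vec_norm (A *\<^sub>v v) \<le> frobenius_norm A * vec_norm v"
proof -
  have entry: "(norm ((A *\<^sub>v v) $ i))\<^sup>2 \<le> (\<Sum>j<dim_col A. (norm (A $$ (i, j)))\<^sup>2) * (vec_norm v)\<^sup>2"
    if i: "i < dim_row A" for i
  proof -
    have "norm ((A *\<^sub>v v) $ i) \<le> (\<Sum>j<dim_col A. norm (A $$ (i, j)) * norm (v $ j))"
      using i v by (auto simp: scalar_prod_def atLeast0LessThan norm_mult[symmetric] intro: norm_sum)
    also have "\<dots> \<le> L2_set (\<lambda>j. norm (A $$ (i, j))) {..<dim_col A} * L2_set (\<lambda>j. norm (v $ j)) {..<dim_col A}"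
      using L2_set_mult_ineq[of "\<lambda>j. norm (A $$ (i, j))" "\<lambda>j. norm (v $ j)" "{..<dim_col A}"]
      by simp
    finally have "(norm ((A *\<^sub>v v) $ i))\<^sup>2
        \<le> (L2_set (\<lambda>j. norm (A $$ (i, j))) {..<dim_col A} * L2_set (\<lambda>j. norm (v $ j)) {..<dim_col A})\<^sup>2"
      by (intro power_mono) auto
    thus ?thesis
      using v by (simp add: vec_norm_sq power_mult_distrib L2_set_def sum_nonneg)
  qed
  have "(vec_norm (A *\<^sub>v v))\<^sup>2 \<le> (\<Sum>i<dim_row A. (\<Sum>j<dim_col A. (norm (A $$ (i, j)))\<^sup>2) * (vec_norm v)\<^sup>2)"
    unfolding vec_norm_sq[of "A *\<^sub>v v"] dim_mult_mat_vec by (intro sum_mono entry) simp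
  also have "\<dots> = (frobenius_norm A * vec_norm v)\<^sup>2"
    by (simp add: frobenius_norm_sq power_mult_distrib sum_distrib_right)
  finally show ?thesis by (rule power2_le_imp_le) simp
qed

text \<open>The supremum in \<open>spectral_norm\<close> is meaningful only over a nonempty set that
  is bounded above: the zero vector supplies the first, the Frobenius bound the second.\<close>

lemma spectral_norm_le_frobenius_norm: "spectral_norm A \<le> frobenius_norm A"
  and spectral_norm_nonneg: "0 \<le> spectral_norm A"
proof -
  let ?U = "{v \<in> carrier_vec (dim_col A). vec_norm v \<le> 1}"
  have bound: "vec_norm (A *\<^sub>v v) \<le> frobenius_norm A" if "v \<in> ?U" for v
    using vec_norm_mult_mat_vec_le[of v A] that mult_left_mono[of "vec_norm v" 1 "frobenius_norm A"]
    by auto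
  have zero: "0\<^sub>v (dim_col A) \<in> ?U"
    by (simp add: vec_norm_def L2_set_def)
  show "spectral_norm A \<le> frobenius_norm A"
    unfolding spectral_norm_def using zero bound by (intro cSUP_least) blast+
  have "vec_norm (A *\<^sub>v 0\<^sub>v (dim_col A)) \<le> spectral_norm A"
    unfolding spectral_norm_def using zero bound by (intro cSUP_upper) (auto intro!: bdd_aboveI2)
  thus "0 \<le> spectral_norm A" using vec_norm_nonneg order_trans by blast
qed

lemma spectral_cond_le_frobenius_cond: "spectral_cond F \<le> frobenius_cond F"
  unfolding spectral_cond_def frobenius_cond_def
  by (intro mult_mono spectral_norm_le_frobenius_norm spectral_norm_nonneg) simp

section \<open>The pseudoinverse of a QR product\<close>

text \<open>Since AYA = A, AX = (AY)(AX). All these products are Hermitian, so this equals the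
  adjoint of (AX)(AY) = AY, that is, AY itself. Similarly XA = YA, and then X = XAX = YAX = YAY =
  Y.\<close>

lemma penrose_unique:
  fixes A :: "'k::conjugatable_field mat"
  assumes A: "A \<in> carrier_mat n p"
    and X: "X \<in> carrier_mat p n" "A * X * A = A" "X * A * X = X"
      "mat_adjoint (A * X) = A * X" "mat_adjoint (X * A) = X * A"
    and Y: "Y \<in> carrier_mat p n" "A * Y * A = A" "Y * A * Y = Y"
      "mat_adjoint (A * Y) = A * Y" "mat_adjoint (Y * A) = Y * A"
  shows "X = Y"
proof -
  have AX: "A * X * (A * Y) = A * Y"
    using assoc_mult_mat[OF mult_carrier_mat[OF A X(1)] A Y(1)] X(2) by metis
  have XA: "Y * A * (X * A) = Y * A"
  proof -
    have "Y * A * (X * A) = Y * (A * (X * A))"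
      using A X(1) Y(1) by (intro assoc_mult_mat) auto
    also have "A * (X * A) = A"
      using assoc_mult_mat[OF A X(1) A] X(2) by metis
    finally show ?thesis .
  qed
  have "A * X = A * Y * (A * X)"
    using assoc_mult_mat[OF mult_carrier_mat[OF A Y(1)] A X(1)] Y(2) by metis
  also have "\<dots> = mat_adjoint (A * Y) * mat_adjoint (A * X)"
    by (simp only: X(4) Y(4))
  also have "\<dots> = A * Y"
    using A X(1) Y(1) by (subst mat_adjoint_mult[symmetric]) (simp_all add: AX Y(4))
  finally have 1: "A * X = A * Y" .
  have "X * A = X * (A * (Y * A))"
    using assoc_mult_mat[OF A Y(1) A] Y(2) by metis
  also have "\<dots> = X * A * (Y * A)"
    using A X(1) Y(1) by (intro assoc_mult_mat[symmetric]) auto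
  also have "\<dots> = mat_adjoint (X * A) * mat_adjoint (Y * A)"
    by (simp only: X(5) Y(5))
  also have "\<dots> = Y * A"
    using A X(1) Y(1) by (subst mat_adjoint_mult[symmetric]) (simp_all add: XA Y(5))
  finally have 2: "X * A = Y * A" .
  have "X = Y * A * X" using X(3) 2 by simp
  also have "\<dots> = Y * (A * X)" using A X(1) Y(1) by (intro assoc_mult_mat) auto
  also have "\<dots> = Y * A * Y" unfolding 1 using A Y(1) by (intro assoc_mult_mat[symmetric]) auto
  finally show ?thesis by (simp add: Y(3))
qed

text \<open>Uniqueness makes the definite description in \<open>pseudoinverse\<close> usable:
  exhibiting one solution of the Penrose equations identifies it.\<close>

lemma pseudoinverse_eqI:
  fixes A :: "'k::conjugatable_field mat"
  assumes "A \<in> carrier_mat n p"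
    and "X \<in> carrier_mat p n" "A * X * A = A" "X * A * X = X"
      "mat_adjoint (A * X) = A * X" "mat_adjoint (X * A) = X * A"
  shows "pseudoinverse A = X"
  unfolding pseudoinverse_def
proof (rule the_equality)
  show "X \<in> carrier_mat (dim_col A) (dim_row A) \<and> A * X * A = A \<and> X * A * X = X
      \<and> mat_adjoint (A * X) = A * X \<and> mat_adjoint (X * A) = X * A"
    using assms by simp
next
  fix Y
  assume Y: "Y \<in> carrier_mat (dim_col A) (dim_row A) \<and> A * Y * A = A \<and> Y * A * Y = Y
      \<and> mat_adjoint (A * Y) = A * Y \<and> mat_adjoint (Y * A) = Y * A"
  have "Y \<in> carrier_mat p n" using Y assms(1) by blast
  thus "Y = X"
    by (rule penrose_unique[OF assms(1) _ _ _ _ _ assms(2-6)]) (use Y in blast)+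
qed

text \<open>For X = S Q^H the products collapse: FX = Q Q^H because R S = 1, and XF = 1 because Q^H
  Q = 1 and S R = 1. Both are Hermitian, and the Penrose equations follow.\<close>

lemma pseudoinverse_QR:
  fixes F :: "'k::real_or_complex mat"
  assumes F: "F \<in> carrier_mat n p" and QR: "economy_QR F Q R"
    and S: "S \<in> carrier_mat p p" "S * R = 1\<^sub>m p" "R * S = 1\<^sub>m p"
  shows "pseudoinverse F = S * mat_adjoint Q"
proof (rule pseudoinverse_eqI[OF F])
  have Q: "Q \<in> carrier_mat n p" "mat_adjoint Q * Q = 1\<^sub>m p"
    and R: "R \<in> carrier_mat p p" and F_eq: "F = Q * R"
    using QR F by (auto simp: economy_QR_def)
  have Q': "mat_adjoint Q \<in> carrier_mat p n" using Q by simp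
  show "S * mat_adjoint Q \<in> carrier_mat p n" using S(1) Q' by simp
  have "F * (S * mat_adjoint Q) = Q * (R * (S * mat_adjoint Q))"
    unfolding F_eq using Q(1) R S(1) Q' by (intro assoc_mult_mat) auto
  also have "R * (S * mat_adjoint Q) = mat_adjoint Q"
    using S R Q' by (simp flip: assoc_mult_mat[of R p p S p "mat_adjoint Q" n])
  finally have FX: "F * (S * mat_adjoint Q) = Q * mat_adjoint Q" .
  have "S * mat_adjoint Q * F = S * (mat_adjoint Q * (Q * R))"
    unfolding F_eq using Q(1) R S(1) Q' by (intro assoc_mult_mat) auto
  also have "mat_adjoint Q * (Q * R) = R"
    using Q Q' R by (simp flip: assoc_mult_mat[of "mat_adjoint Q" p n Q p R p])
  finally have XF: "S * mat_adjoint Q * F = 1\<^sub>m p" by (simp add: S)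
  show "F * (S * mat_adjoint Q) * F = F"
    using F S(1) Q' by (simp add: assoc_mult_mat[of F n p "S * mat_adjoint Q" n F p] XF)
  show "S * mat_adjoint Q * F * (S * mat_adjoint Q) = S * mat_adjoint Q"
    unfolding XF using S(1) Q' by simp
  show "mat_adjoint (F * (S * mat_adjoint Q)) = F * (S * mat_adjoint Q)"
    unfolding FX using Q(1) by (simp add: mat_adjoint_mult)
  show "mat_adjoint (S * mat_adjoint Q * F) = S * mat_adjoint Q * F"
    unfolding XF by simp
qed

text \<open>Passing to the adjoint turns S Q^H into Q S^H, where \<open>Q\<close> stands on the left
  and acts as an isometry on the columns.\<close>

lemma frobenius_norm_pseudoinverse_QR:
  fixes F :: "'k::real_or_complex mat"
  assumes F: "F \<in> carrier_mat n p" and QR: "economy_QR F Q R"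
    and S: "S \<in> carrier_mat p p" "S * R = 1\<^sub>m p" "R * S = 1\<^sub>m p"
  shows "frobenius_norm (pseudoinverse F) = frobenius_norm S"
proof -
  have Q: "Q \<in> carrier_mat n p" "mat_adjoint Q * Q = 1\<^sub>m p"
    using QR F by (auto simp: economy_QR_def)
  have "frobenius_norm (pseudoinverse F) = frobenius_norm (mat_adjoint (S * mat_adjoint Q))"
    by (simp add: pseudoinverse_QR[OF assms])
  also have "mat_adjoint (S * mat_adjoint Q) = Q * mat_adjoint S"
    using Q(1) S(1) by (simp add: mat_adjoint_mult)
  also have "frobenius_norm \<dots> = frobenius_norm (mat_adjoint S)"
    using Q S(1) by (intro frobenius_norm_isometry) auto
  finally show ?thesis by simp
qed

section \<open>Inverses of upper triangular matrices\<close>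

lemma mult_mat_unit_vec:
  fixes A :: "'a::semiring_1 mat"
  assumes "j < dim_col A"
  shows "A *\<^sub>v unit_vec (dim_col A) j = col A j"
  using assms by (intro eq_vecI) (simp_all add: scalar_prod_right_unit[of j "dim_col A"])

text \<open>Back substitution: subtracting a multiple of the last relevant column of
  \<open>R\<close> clears the last nonzero entry of \<open>w\<close>. Only the first
  \<open>t\<close> diagonal entries are assumed nonzero, so the lemma applies while the rest of the
  diagonal is still being estimated.\<close>

lemma upper_triangular_solve:
  fixes R :: "'k::field mat"
  assumes R: "R \<in> carrier_mat p p" "upper_triangular R"
    and "t \<le> p" and "\<forall>i<t. R $$ (i, i) \<noteq> 0"
    and "w \<in> carrier_vec p" and "\<forall>i\<in>{t..<p}. w $ i = 0"
  shows "\<exists>y \<in> carrier_vec p. (\<forall>i\<in>{t..<p}. y $ i = 0) \<and> R *\<^sub>v y = w"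
  using assms(3-)
proof (induction t arbitrary: w)
  case 0
  hence "w = 0\<^sub>v p" by auto
  moreover have "R *\<^sub>v 0\<^sub>v p = 0\<^sub>v p"
    using R(1) by auto
  ultimately show ?case
    by (intro bexI[of _ "0\<^sub>v p"]) auto
next
  case (Suc t)
  define c where "c = w $ t / R $$ (t, t)"
  define w' where "w' = w - c \<cdot>\<^sub>v col R t"
  have t: "t < p" "R $$ (t, t) \<noteq> 0" using Suc.prems by auto
  have w': "w' \<in> carrier_vec p" using R by (intro carrier_vecI) (simp add: w'_def)
  have "w' $ i = 0" if "i \<in> {t..<p}" for i
  proof (cases "i = t")
    case True
    thus ?thesis using t R Suc.prems by (simp add: w'_def c_def)
  next
    case False
    hence "w $ i = 0" "R $$ (i, t) = 0"
      using that Suc.prems R upper_triangularD[of R t i] by auto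
    thus ?thesis using that t R Suc.prems by (simp add: w'_def)
  qed
  then obtain y where y: "y \<in> carrier_vec p" "\<forall>i\<in>{t..<p}. y $ i = 0" "R *\<^sub>v y = w'"
    using Suc.IH[of w'] Suc.prems w' by auto
  have "R *\<^sub>v (y + c \<cdot>\<^sub>v unit_vec p t) = R *\<^sub>v y + R *\<^sub>v (c \<cdot>\<^sub>v unit_vec p t)"
    using R y(1) by (intro mult_add_distrib_mat_vec) auto
  also have "R *\<^sub>v (c \<cdot>\<^sub>v unit_vec p t) = c \<cdot>\<^sub>v col R t"
    using R t mult_mat_unit_vec[of t R] by (simp add: mult_mat_vec[of R p p])
  also have "R *\<^sub>v y + c \<cdot>\<^sub>v col R t = w"
    unfolding y(3) w'_def using Suc.prems R t by (intro eq_vecI) auto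
  finally show ?case
    using y t by (intro bexI[of _ "y + c \<cdot>\<^sub>v unit_vec p t"]) auto
qed

text \<open>Exact solution of u_0 = 1, u_d = t (u_0 + ... + u_(d-1)). It serves as the bound for
  |s_(i,i+d)| / |s_ii|.\<close>

definition inv_growth :: "real \<Rightarrow> nat \<Rightarrow> real" where
  "inv_growth t d = (if d = 0 then 1 else t * (1 + t) ^ (d - 1))"

lemma inv_growth_nonneg: "0 \<le> t \<Longrightarrow> 0 \<le> inv_growth t d"
  by (simp add: inv_growth_def)

text \<open>The third assumption keeps 0 apart from the positive distances: for t < 1 the value
  drops from 1 at d = 0 to t at d = 1.\<close>

lemma inv_growth_mono:
  assumes "0 \<le> t" "d \<le> d'" "d = 0 \<longleftrightarrow> d' = 0"
  shows "inv_growth t d \<le> inv_growth t d'"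
  using assms by (auto simp: inv_growth_def intro!: mult_left_mono power_increasing)

context
  fixes R S :: "'k::real_normed_field mat" and p :: nat
  assumes R: "R \<in> carrier_mat p p" "upper_triangular R" "\<And>i. i < p \<Longrightarrow> R $$ (i, i) \<noteq> 0"
    and S: "S \<in> carrier_mat p p" "S * R = 1\<^sub>m p"
begin

lemma left_inverse_entry:
  assumes "i < p" "j < p"
  shows "(\<Sum>k\<le>j. S $$ (i, k) * R $$ (k, j)) = (if i = j then 1 else 0)"
proof -
  have "(\<Sum>k\<le>j. S $$ (i, k) * R $$ (k, j)) = (\<Sum>k<p. S $$ (i, k) * R $$ (k, j))"
    using assms R upper_triangularD[OF R(2)] by (intro sum.mono_neutral_left) auto
  also have "\<dots> = (S * R) $$ (i, j)"
    using assms R(1) S(1) by (simp add: scalar_prod_def atLeast0LessThan)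
  finally show ?thesis using assms S(2) by simp
qed

text \<open>In entry (i, j) of \<open>S * R = 1\<close>, the entries of row \<open>i\<close> of
  \<open>S\<close> left of column \<open>j\<close> vanish by induction, which leaves s_ij r_jj =
  0.\<close>

lemma left_inverse_upper_triangular: "j < i \<Longrightarrow> i < p \<Longrightarrow> S $$ (i, j) = 0"
proof (induction j rule: less_induct)
  case (less j)
  have "(\<Sum>k<j. S $$ (i, k) * R $$ (k, j)) = 0"
    using less by (intro sum.neutral) auto
  thus ?case
    using left_inverse_entry[of i j] less.prems R(3)[of j] by (simp flip: lessThan_Suc_atMost)
qed

lemma left_inverse_entry_upper:
  assumes "i \<le> j" "j < p"
  shows "(\<Sum>k\<in>{i..j}. S $$ (i, k) * R $$ (k, j)) = (if i = j then 1 else 0)"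
proof -
  have "(\<Sum>k\<in>{i..j}. S $$ (i, k) * R $$ (k, j)) = (\<Sum>k\<le>j. S $$ (i, k) * R $$ (k, j))"
    using assms left_inverse_upper_triangular by (intro sum.mono_neutral_left) auto
  thus ?thesis using left_inverse_entry[of i j] assms by simp
qed

lemma norm_left_inverse_diag: "i < p \<Longrightarrow> norm (S $$ (i, i)) = 1 / norm (R $$ (i, i))"
  using left_inverse_entry_upper[of i i] R(3)[of i]
  by (simp add: norm_mult[symmetric] field_simps)

lemma norm_left_inverse_le:
  assumes t: "0 \<le> t"
    and off: "\<And>k j. k < j \<Longrightarrow> j < p \<Longrightarrow> norm (R $$ (k, j)) \<le> t * norm (R $$ (j, j))"
    and ij: "i \<le> j" "j < p"
  shows "norm (S $$ (i, j)) \<le> norm (S $$ (i, i)) * inv_growth t (j - i)"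
proof -
  let ?s = "\<lambda>k. norm (S $$ (i, k))"
  \<comment> \<open>Entry (i, j) of \<open>S * R = 1\<close> expresses s_ij r_jj by the earlier
    entries of row \<open>i\<close>; the off-diagonal bound then allows |r_jj| to be
    cancelled.\<close>
  have rec: "?s j \<le> t * (\<Sum>k\<in>{i..<j}. ?s k)" if j: "i < j" "j < p" for j
  proof -
    have "S $$ (i, j) * R $$ (j, j) + (\<Sum>k\<in>{i..<j}. S $$ (i, k) * R $$ (k, j))
        = (\<Sum>k\<in>{i..j}. S $$ (i, k) * R $$ (k, j))"
      using j by (subst sum.last_plus) simp_all
    also have "\<dots> = 0" using left_inverse_entry_upper[of i j] j by simp
    finally have *: "S $$ (i, j) * R $$ (j, j) = - (\<Sum>k\<in>{i..<j}. S $$ (i, k) * R $$ (k, j))"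
      by (simp only: eq_neg_iff_add_eq_0)
    have "?s j * norm (R $$ (j, j)) = norm (S $$ (i, j) * R $$ (j, j))"
      by (rule norm_mult[symmetric])
    also have "\<dots> = norm (\<Sum>k\<in>{i..<j}. S $$ (i, k) * R $$ (k, j))"
      by (simp only: * norm_minus_cancel)
    also have "\<dots> \<le> (\<Sum>k\<in>{i..<j}. ?s k * (t * norm (R $$ (j, j))))"
      using j off by (intro sum_norm_le) (auto simp: norm_mult intro!: mult_left_mono)
    also have "\<dots> = (t * (\<Sum>k\<in>{i..<j}. ?s k)) * norm (R $$ (j, j))"
      by (simp add: sum_distrib_left sum_distrib_right mult_ac)
    finally show ?thesis using R(3)[OF j(2)] by simp
  qed
  \<comment> \<open>Each new entry adds at most t times the sum so far, so the partial sums grow at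
    most by the factor 1 + t.\<close>
  have acc: "i + d < p \<Longrightarrow> (\<Sum>k\<in>{i..<Suc (i + d)}. ?s k) \<le> ?s i * (1 + t) ^ d" for d
  proof (induction d)
    case (Suc d)
    have "(\<Sum>k\<in>{i..<Suc (i + Suc d)}. ?s k) = (\<Sum>k\<in>{i..<Suc (i + d)}. ?s k) + ?s (i + Suc d)"
      by simp
    also have "\<dots> \<le> (1 + t) * (\<Sum>k\<in>{i..<Suc (i + d)}. ?s k)"
      using rec[of "i + Suc d"] Suc.prems by (simp add: algebra_simps)
    also have "\<dots> \<le> (1 + t) * (?s i * (1 + t) ^ d)"
      using Suc t by (intro mult_left_mono) auto
    finally show ?case by (simp add: mult_ac)
  qed simp
  show ?thesis
  proof (cases "i = j")
    case False
    define d where "d = j - i - 1"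
    have j: "j = Suc (i + d)" using False ij by (simp add: d_def)
    have "?s j \<le> t * (\<Sum>k\<in>{i..<j}. ?s k)" using rec[of j] False ij by simp
    also have "\<dots> \<le> t * (?s i * (1 + t) ^ d)"
      using acc[of d] t ij unfolding j by (intro mult_left_mono) auto
    finally show ?thesis by (simp add: inv_growth_def j mult_ac)
  qed (simp add: inv_growth_def)
qed

end

section \<open>The two filters\<close>

text \<open>Upper bound for \<open>|s_ii|\<close>; the first column needs no factor \<open>c_s\<close> because \<open>|r_11| = \<parallel>f_1\<parallel>\<close>.\<close>

definition lf_inv_diag :: "real \<Rightarrow> 'k::real_normed_field mat \<Rightarrow> nat \<Rightarrow> real" where
  "lf_inv_diag cs F i = 1 / ((if i = 1 then 1 else cs) * col_norm F i)"

text \<open>With t = ct / cs one has 1 + t = (ct + cs) / cs, so the squared bounds on the entries of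
  column \<open>j\<close> of the inverse are the summands used by the filter. The case split follows
  the definition of \<open>lf_b\<close>.\<close>

lemma lf_b_eq:
  assumes cs: "0 < cs" and j: "1 \<le> j"
  shows "lf_b cs F j = (\<Sum>i = 1..j. (lf_inv_diag cs F i * inv_growth (sqrt (1 - cs\<^sup>2) / cs) (j - i))\<^sup>2)"
proof -
  define ct where "ct = sqrt (1 - cs\<^sup>2)"
  have step: "(inv_growth (ct / cs) (j - i))\<^sup>2
      = ct\<^sup>2 * (ct + cs) ^ (2 * (j - i - 1)) / cs ^ (2 * (j - i))" if ij: "i < j" for i
  proof -
    obtain d where d: "j - i = Suc d" using ij by (metis Suc_diff_Suc)
    have "1 + ct / cs = (ct + cs) / cs" using cs by (simp add: field_simps)
    thus ?thesis
      using cs by (simp add: inv_growth_def d power_divide power_mult_distrib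
          power_mult[symmetric] mult.commute[of _ 2] power_add[symmetric])
  qed
  consider "j = 1" | "j = 2" | "3 \<le> j" using j by linarith
  thus ?thesis
  proof cases
    case 1
    thus ?thesis by (simp add: lf_b_def lf_inv_diag_def inv_growth_def power_divide)
  next
    case 2
    have "{1..2::nat} = {1, 2}" by auto
    thus ?thesis
      using 2 cs by (simp add: lf_b_def lf_inv_diag_def inv_growth_def power_divide power_mult_distrib
          ct_def[symmetric] Let_def distrib_left mult_ac del: One_nat_def)
  next
    case 3
    have split: "{1..j} = insert 1 (insert j {2..j - 1})" using 3 by auto
    \<comment> \<open>In the first column \<open>lf_inv_diag\<close> contributes no 1 / cs; the
      common factor 1 / cs^2 is split off from cs^(2 (j - 1)) instead.\<close>
    have first: "(lf_inv_diag cs F 1 * inv_growth (ct / cs) (j - 1))\<^sup>2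
        = 1 / cs\<^sup>2 * (ct\<^sup>2 * (ct + cs) ^ (2 * (j - 2)) / ((col_norm F 1)\<^sup>2 * cs ^ (2 * (j - 2))))"
    proof -
      define d where "d = j - 2"
      have d: "j = Suc (Suc d)" using 3 by (simp add: d_def)
      show ?thesis
        unfolding power_mult_distrib using 3 step[of 1] cs
        by (simp add: d lf_inv_diag_def power_divide power_add power2_eq_square)
    qed
    have mid: "(lf_inv_diag cs F i * inv_growth (ct / cs) (j - i))\<^sup>2
        = 1 / cs\<^sup>2 * (ct\<^sup>2 * (ct + cs) ^ (2 * (j - i - 1)) / ((col_norm F i)\<^sup>2 * cs ^ (2 * (j - i))))"
      if "i \<in> {2..j - 1}" for i
      unfolding power_mult_distrib using 3 step[of i] that
      by (auto simp add: lf_inv_diag_def power_divide power_mult_distrib)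
    have last: "(lf_inv_diag cs F j * inv_growth (ct / cs) (j - j))\<^sup>2 = 1 / cs\<^sup>2 * (1 / (col_norm F j)\<^sup>2)"
      using 3 by (simp add: lf_inv_diag_def inv_growth_def power_divide power_mult_distrib)
    have "(\<Sum>i = 1..j. (lf_inv_diag cs F i * inv_growth (ct / cs) (j - i))\<^sup>2)
        = (lf_inv_diag cs F 1 * inv_growth (ct / cs) (j - 1))\<^sup>2
          + ((lf_inv_diag cs F j * inv_growth (ct / cs) (j - j))\<^sup>2
          + (\<Sum>i = 2..j - 1. (lf_inv_diag cs F i * inv_growth (ct / cs) (j - i))\<^sup>2))"
      unfolding split using 3 by (subst sum.insert | force)+
    also have "\<dots> = lf_b cs F j"
      unfolding first last using 3 mid
      by (simp add: lf_b_def Let_def ct_def[symmetric] distrib_left sum_distrib_left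
          del: One_nat_def)
    finally show ?thesis by (simp add: ct_def)
  qed
qed

section \<open>Selection of columns\<close>

lemma dim_keep_cols [simp]:
  "dim_row (keep_cols I A) = dim_row A"
  "dim_col (keep_cols I A) = card {i. i < dim_col A \<and> i \<in> I}"
  by (simp_all add: keep_cols_def length_nths)

lemma dim_col_keep_cols: "I \<subseteq> {..<dim_col A} \<Longrightarrow> dim_col (keep_cols I A) = card I"
  by (simp, rule arg_cong[of _ _ card]) auto

lemma keep_cols_carrier:
  "A \<in> carrier_mat n p \<Longrightarrow> I \<subseteq> {..<p} \<Longrightarrow> keep_cols I A \<in> carrier_mat n (card I)"
  using dim_col_keep_cols[of I A] by (intro carrier_matI) auto

lemma cols_keep_cols: "cols (keep_cols I A) = nths (cols A) I"
  unfolding keep_cols_def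
  using cols_dim[of A] set_nths_subset[of "cols A" I] by (intro cols_mat_of_cols) blast

text \<open>\<open>pick I\<close> enumerates \<open>I\<close> in increasing order, from position 0,
  and so translates positions in the smaller matrix into original column numbers.\<close>

lemma col_keep_cols:
  assumes "I \<subseteq> {..<dim_col A}" "j < card I"
  shows "col (keep_cols I A) j = col A (pick I j)"
proof -
  have I: "{i. i < length (cols A) \<and> i \<in> I} = I" using assms(1) by auto
  have "pick I j \<in> I" using assms(2) by (rule pick_in_set_le)
  hence "pick I j < dim_col A" using assms(1) by auto
  moreover have "col (keep_cols I A) j = cols (keep_cols I A) ! j"
    using assms dim_col_keep_cols[OF assms(1)] by (simp del: dim_keep_cols)
  ultimately show ?thesis
    unfolding cols_keep_cols using assms(2) by (simp add: nth_nths[of j "cols A" I, unfolded I])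
qed

lemma pick_lessThan: "j < l \<Longrightarrow> pick {..<l} j = j"
proof -
  assume "j < l"
  moreover from this have "{a \<in> {..<l}. a < j} = {..<j}" by auto
  ultimately show ?thesis using pick_card_in_set[of j "{..<l}"] by simp
qed

lemma pick_0: "0 \<in> I \<Longrightarrow> pick I 0 = 0"
  by (simp add: Least_equality)

lemma col_keep_initial_cols: "l \<le> dim_col A \<Longrightarrow> j < l \<Longrightarrow> col (keep_cols {..<l} A) j = col A j"
  by (subst col_keep_cols) (auto simp: pick_lessThan)

lemma set_cols_keep_initial_cols:
  "l \<le> dim_col A \<Longrightarrow> set (cols (keep_cols {..<l} A)) = col A ` {..<l}"
  by (auto simp: cols_keep_cols set_nths image_def simp del: nths_upt_eq_take) (metis cols_nth less_le_trans)+

lemma col_norm_keep_initial_cols: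
  "l \<le> dim_col A \<Longrightarrow> 1 \<le> i \<Longrightarrow> i \<le> l \<Longrightarrow> col_norm (keep_cols {..<l} A) i = col_norm A i"
  by (simp add: col_norm_def col_keep_initial_cols)

lemma lf_b_cong:
  assumes "\<And>i. 1 \<le> i \<Longrightarrow> i \<le> j \<Longrightarrow> col_norm F i = col_norm G i" "1 \<le> j"
  shows "lf_b cs F j = lf_b cs G j"
  unfolding lf_b_def Let_def using assms by (auto intro!: arg_cong2[of _ _ _ _ "(+)"] sum.cong)

text \<open>\<open>lf_CF\<close> at \<open>l\<close> reads only the first \<open>l\<close> columns,
  so a test passed before the truncation still holds after it.\<close>

lemma lf_CF_keep_initial_cols:
  "l \<le> dim_col F \<Longrightarrow> lf_CF cs (keep_cols {..<l} F) l = lf_CF cs F l"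
  unfolding lf_CF_def
  by (intro arg_cong2[of _ _ _ _ "(*)"] sum.cong refl)
    (auto simp: col_norm_keep_initial_cols intro!: lf_b_cong)

section \<open>Distances to column spaces, the diagonal of R, and rank\<close>

lemma in_col_space_keep_initial_cols:
  fixes F :: "'k::field mat"
  assumes F: "F \<in> carrier_mat n p" and j: "j \<le> p"
    and y: "y \<in> carrier_vec p" "\<forall>i\<in>{j..<p}. y $ i = 0"
  shows "F *\<^sub>v y \<in> vec_space.col_space n (keep_cols {..<j} F)"
proof -
  interpret vec_space "TYPE('k)" n .
  have K: "keep_cols {..<j} F \<in> carrier_mat n j"
    using keep_cols_carrier[OF F, of "{..<j}"] j by auto
  have "keep_cols {..<j} F *\<^sub>v vec j (($) y) = F *\<^sub>v y"
  proof (rule eq_vecI)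
    fix r assume "r < dim_vec (F *\<^sub>v y)"
    hence r: "r < n" using F by simp
    have "(F *\<^sub>v y) $ r = (\<Sum>i<p. F $$ (r, i) * y $ i)"
      using F r y(1) by (simp add: scalar_prod_def atLeast0LessThan)
    also have "\<dots> = (\<Sum>i<j. F $$ (r, i) * y $ i)"
      using j y(2) by (intro sum.mono_neutral_right) auto
    also have "\<dots> = (\<Sum>i<j. keep_cols {..<j} F $$ (r, i) * y $ i)"
    proof (rule sum.cong)
      fix i assume i: "i \<in> {..<j}"
      have "keep_cols {..<j} F $$ (r, i) = col (keep_cols {..<j} F) i $ r"
        using K i r by (intro index_col[symmetric]) auto
      thus "F $$ (r, i) * y $ i = keep_cols {..<j} F $$ (r, i) * y $ i"
        using F i j r by (simp add: col_keep_initial_cols)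
    qed simp
    also have "\<dots> = (keep_cols {..<j} F *\<^sub>v vec j (($) y)) $ r"
      using K r by (simp add: scalar_prod_def atLeast0LessThan del: dim_keep_cols)
    finally show "(keep_cols {..<j} F *\<^sub>v vec j (($) y)) $ r = (F *\<^sub>v y) $ r" by simp
  qed (use F in simp)
  moreover have "keep_cols {..<j} F *\<^sub>v vec j (($) y) \<in> carrier_vec n"
    using K by auto
  ultimately show ?thesis
    unfolding col_space_eq[OF K] using K by (auto intro!: bexI[of _ "vec j (($) y)"])
qed

lemma vec_norm_mult_QR:
  fixes F :: "'k::real_or_complex mat"
  assumes F: "F \<in> carrier_mat n p" and QR: "economy_QR F Q R" and v: "v \<in> carrier_vec p"
  shows "vec_norm (F *\<^sub>v v) = vec_norm (R *\<^sub>v v)"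
proof -
  have Q: "Q \<in> carrier_mat n p" "mat_adjoint Q * Q = 1\<^sub>m p"
    and R: "R \<in> carrier_mat p p" and F_eq: "F = Q * R"
    using QR F by (auto simp: economy_QR_def)
  have "F *\<^sub>v v = Q *\<^sub>v (R *\<^sub>v v)"
    unfolding F_eq using Q(1) R v by (rule assoc_mult_mat_vec)
  thus ?thesis using Q R v by (simp add: vec_norm_isometry[of Q n p])
qed

lemma vec_norm_smult_unit_vec: "j < p \<Longrightarrow> vec_norm (a \<cdot>\<^sub>v unit_vec p j) = norm a"
proof -
  assume j: "j < p"
  have "(vec_norm (a \<cdot>\<^sub>v unit_vec p j))\<^sup>2 = (\<Sum>i<p. if i = j then (norm a)\<^sup>2 else 0)"
    unfolding vec_norm_sq using j by (intro sum.cong) auto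
  hence "(vec_norm (a \<cdot>\<^sub>v unit_vec p j))\<^sup>2 = (norm a)\<^sup>2" using j by simp
  thus ?thesis by (simp add: power2_eq_iff_nonneg)
qed

text \<open>Back substitution gives a combination of the earlier columns that matches the part of
  column \<open>j\<close> of \<open>R\<close> above the diagonal. Subtracting it from f_j leaves
  r_jj times column \<open>j\<close> of \<open>Q\<close>, so |r_jj| is itself one of the distances
  bounded below by \<open>\<delta>\<close>.\<close>

lemma dist_le_norm_QR_diag:
  fixes F :: "'k::real_or_complex mat"
  assumes F: "F \<in> carrier_mat n p" and QR: "economy_QR F Q R"
    and j: "j < p" and diag: "\<forall>i<j. R $$ (i, i) \<noteq> 0"
    and dist: "\<And>v. v \<in> vec_space.col_space n (keep_cols {..<j} F) \<Longrightarrow> \<delta> \<le> vec_norm (col F j - v)"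
  shows "\<delta> \<le> norm (R $$ (j, j))"
proof -
  have R: "R \<in> carrier_mat p p" "upper_triangular R"
    using QR F by (auto simp: economy_QR_def)
  define w where "w = vec p (\<lambda>i. if i < j then R $$ (i, j) else 0)"
  obtain y where y: "y \<in> carrier_vec p" "\<forall>i\<in>{j..<p}. y $ i = 0" "R *\<^sub>v y = w"
    using upper_triangular_solve[OF R less_imp_le[OF j] diag, of w] by (auto simp: w_def)
  let ?e = "unit_vec p j :: 'k vec"
  have "col F j - F *\<^sub>v y = F *\<^sub>v (?e - y)"
    using F j y(1) mult_mat_unit_vec[of j F] by (simp add: mult_minus_distrib_mat_vec[OF F])
  hence "vec_norm (col F j - F *\<^sub>v y) = vec_norm (R *\<^sub>v (?e - y))"
    using vec_norm_mult_QR[OF F QR, of "?e - y"] y(1) by simp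
  also have "R *\<^sub>v (?e - y) = R $$ (j, j) \<cdot>\<^sub>v ?e"
  proof (rule eq_vecI)
    fix i assume "i < dim_vec (R $$ (j, j) \<cdot>\<^sub>v ?e)"
    hence i: "i < p" by simp
    have "R *\<^sub>v (?e - y) = col R j - w"
      using R(1) j y mult_mat_unit_vec[of j R] by (simp add: mult_minus_distrib_mat_vec[OF R(1)])
    thus "(R *\<^sub>v (?e - y)) $ i = (R $$ (j, j) \<cdot>\<^sub>v ?e) $ i"
      using i j R upper_triangularD[OF R(2), of j i] by (auto simp: w_def not_less)
  qed (use R in simp)
  finally show ?thesis
    using dist[OF in_col_space_keep_initial_cols[OF F less_imp_le[OF j] y(1,2)]] j
    by (simp add: vec_norm_smult_unit_vec)
qed

text \<open>\<open>F\<close> has trivial kernel: Fv = 0 forces Rv = 0 and then v = S R v = 0. Linear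
  independence is stated for the set of columns, so their distinctness is shown separately.\<close>

lemma QR_full_rank:
  fixes F :: "'k::real_or_complex mat"
  assumes F: "F \<in> carrier_mat n p" and QR: "economy_QR F Q R"
    and S: "S \<in> carrier_mat p p" "S * R = 1\<^sub>m p"
  shows "vec_space.rank n F = p"
proof -
  interpret vec_space "TYPE('k)" n .
  have R: "R \<in> carrier_mat p p" using QR F by (auto simp: economy_QR_def)
  have inj: "v = 0\<^sub>v p" if v: "v \<in> carrier_vec p" "F *\<^sub>v v = 0\<^sub>v n" for v
  proof -
    have "vec_norm (R *\<^sub>v v) = 0"
      using vec_norm_mult_QR[OF F QR v(1)] v(2) by (simp add: vec_norm_def L2_set_def)
    hence "R *\<^sub>v v = 0\<^sub>v p"
      using R v(1) vec_norm_pos[of "R *\<^sub>v v" p] by force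
    hence "S * R *\<^sub>v v = 0\<^sub>v p"
      using S(1) by (auto simp: assoc_mult_mat_vec[OF S(1) R v(1)])
    thus ?thesis using S v(1) by simp
  qed
  have dist: "distinct (cols F)"
  proof (unfold distinct_conv_nth, intro allI impI)
    fix a b assume ab: "a < length (cols F)" "b < length (cols F)" "a \<noteq> b"
    show "cols F ! a \<noteq> cols F ! b"
    proof
      \<comment> \<open>Two equal columns would put a nonzero difference of unit vectors into the
        kernel.\<close>
      assume "cols F ! a = cols F ! b"
      hence "F *\<^sub>v (unit_vec p a - unit_vec p b) = 0\<^sub>v n"
        using ab F mult_mat_unit_vec[of a F] mult_mat_unit_vec[of b F]
        by (simp add: mult_minus_distrib_mat_vec[OF F])
      hence "unit_vec p a - unit_vec p b = (0\<^sub>v p :: 'k vec)"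
        by (intro inj) auto
      hence "(unit_vec p a - unit_vec p b) $ a = (0\<^sub>v p :: 'k vec) $ a" by simp
      thus False using ab F by simp
    qed
  qed
  have "lin_indpt (set (cols F))"
    using lin_depE[OF F _ dist] inj by blast
  thus ?thesis by (rule lin_indpt_full_rank[OF F dist])
qed

text \<open>The distances are bounded below by 0, so their infimum is at most each of them. The
  index shifts because \<open>af_sine\<close> numbers columns from 1 and \<open>col\<close> from
  0.\<close>

lemma af_sine_le_dist:
  assumes F: "F \<in> carrier_mat n p" and v: "v \<in> vec_space.col_space n (keep_cols {..<j} F)"
    and pos: "0 < vec_norm (col F j)" and le: "cs \<le> af_sine F (Suc j)"
  shows "cs * vec_norm (col F j) \<le> vec_norm (col F j - v)"
proof -
  have "cs * vec_norm (col F j)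
      \<le> (INF v \<in> vec_space.col_space n (keep_cols {..<j} F). vec_norm (col F j - v))"
    using le pos F by (simp add: af_sine_def col_norm_def pos_le_divide_eq)
  also have "\<dots> \<le> vec_norm (col F j - v)"
    using v by (intro cINF_lower bdd_belowI2[of _ 0]) auto
  finally show ?thesis .
qed

text \<open>\<open>pick I\<close> is strictly increasing, so each step in position raises the
  original index by at least one.\<close>

lemma pick_diff_ge: "a \<le> b \<Longrightarrow> b < card I \<Longrightarrow> b - a \<le> pick I b - pick I a"
proof (induction b)
  case (Suc b)
  show ?case
  proof (cases "a = Suc b")
    case False
    hence "b - a \<le> pick I b - pick I a" using Suc by auto
    moreover have "pick I a \<le> pick I b"
      using False Suc.prems pick_mono_le[of b I a] by (cases "a = b") auto
    moreover have "pick I b < pick I (Suc b)"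
      using Suc.prems by (intro pick_mono_le) auto
    ultimately show ?thesis using False Suc.prems by linarith
  qed simp
qed simp

text \<open>The kept columns before a kept one are among all its original predecessors. Hence a sine
  measured by the filter against all predecessors is a lower bound for the sine against the kept
  ones.\<close>

lemma col_space_keep_cols_mono:
  assumes F: "F \<in> carrier_mat n l" and I: "I \<subseteq> {..<l}" and a: "a < card I"
  shows "vec_space.col_space n (keep_cols {..<a} (keep_cols I F))
    \<subseteq> vec_space.col_space n (keep_cols {..<pick I a} F)"
proof -
  interpret vec_space "TYPE('a)" n .
  have I': "I \<subseteq> {..<dim_col F}" using F I by auto
  have "pick I a < l" using pick_in_set_le[OF a] I by auto
  hence "set (cols (keep_cols {..<a} (keep_cols I F))) \<subseteq> set (cols (keep_cols {..<pick I a} F))"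
    using a F pick_mono_le[of a I] dim_col_keep_cols[OF I']
    by (auto simp: set_cols_keep_initial_cols col_keep_cols[OF I'] simp del: dim_keep_cols)
  thus ?thesis unfolding col_space_def by (rule span_is_monotone)
qed

text \<open>\<open>F\<close> stands for the output of the Length Filter and \<open>I\<close> for the
  columns that the Angle Filter keeps. Both squared Frobenius norms are bounded by sums of
  nonnegative terms over the kept columns; these only grow when all \<open>l\<close> columns are
  included, and the product of the full sums is \<open>lf_CF\<close>.\<close>

lemma filtered_QR_cond:
  fixes F :: "'k::real_or_complex mat"
  assumes F: "F \<in> carrier_mat n l" and I: "I \<subseteq> {..<l}" "0 \<in> I"
    and pos: "\<And>i. i < l \<Longrightarrow> 0 < vec_norm (col F i)"
    and cs: "0 < cs" "cs < 1"
    and sines: "\<And>i. i \<in> I \<Longrightarrow> i \<noteq> 0 \<Longrightarrow> cs \<le> af_sine F (Suc i)"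
    and QR: "economy_QR (keep_cols I F) Q R"
  shows "vec_space.rank n (keep_cols I F) = card I"
    and "(frobenius_cond (keep_cols I F))\<^sup>2 \<le> lf_CF cs F l"
proof -
  define G where "G = keep_cols I F"
  define q where "q = card I"
  define N where "N i = vec_norm (col F i)" for i
  define ct where "ct = sqrt (1 - cs\<^sup>2)"
  define t where "t = ct / cs"
  have I': "I \<subseteq> {..<dim_col F}" using F I(1) by auto
  have G: "G \<in> carrier_mat n q" unfolding G_def q_def using F I(1) by (rule keep_cols_carrier)
  have QR: "economy_QR G Q R" using QR by (simp add: G_def)
  have R: "R \<in> carrier_mat q q" "upper_triangular R" using QR G by (auto simp: economy_QR_def)
  have idx: "pick I a < l" "pick I a \<in> I" if "a < q" for a
    using pick_in_set_le[of a I] that I(1) by (auto simp: q_def)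
  have col_G: "col G a = col F (pick I a)" if "a < q" for a
    unfolding G_def using I' that by (intro col_keep_cols) (auto simp: q_def)
  have Npos: "0 < N (pick I a)" if "a < q" for a
    using pos idx[OF that] by (simp add: N_def)
  \<comment> \<open>\<open>Q\<close> is an isometry, so column \<open>a\<close> has the same norm in
    \<open>G\<close> and in \<open>R\<close>, where it ends at the diagonal.\<close>
  have N_sq: "(N (pick I a))\<^sup>2 = (\<Sum>k\<le>a. (norm (R $$ (k, a)))\<^sup>2)" if a: "a < q" for a
  proof -
    have "N (pick I a) = vec_norm (G *\<^sub>v unit_vec q a)"
      using a G mult_mat_unit_vec[of a G] by (simp add: N_def col_G)
    also have "\<dots> = vec_norm (R *\<^sub>v unit_vec q a)"
      by (rule vec_norm_mult_QR[OF G QR]) simp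
    also have "R *\<^sub>v unit_vec q a = col R a"
      using a R mult_mat_unit_vec[of a R] by simp
    finally have "(N (pick I a))\<^sup>2 = (\<Sum>k<q. (norm (R $$ (k, a)))\<^sup>2)"
      using a R by (simp add: vec_norm_sq)
    also have "\<dots> = (\<Sum>k\<le>a. (norm (R $$ (k, a)))\<^sup>2)"
      using a R(1) upper_triangularD[OF R(2), of a] by (intro sum.mono_neutral_right) auto
    finally show ?thesis .
  qed
  \<comment> \<open>Column 0 of \<open>R\<close> consists of its diagonal entry alone, so equality
    holds here without a factor cs.\<close>
  have first: "norm (R $$ (0, 0)) = N 0" if "0 < q"
    using N_sq[OF that] pick_0[OF I(2)]
    by (simp add: N_def power2_eq_iff_nonneg del: pick.simps)
  \<comment> \<open>Strong induction, because comparing |r_aa| with a distance requires the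
    preceding diagonal entries to be nonzero.\<close>
  have diag: "cs * N (pick I a) \<le> norm (R $$ (a, a))" if "a < q" for a
    using that
  proof (induction a rule: less_induct)
    case (less a)
    show ?case
    proof (cases "a = 0")
      case True
      thus ?thesis
        using first less.prems pick_0[OF I(2)] cs Npos[of 0]
        by (simp add: mult_left_le_one_le del: pick.simps)
    next
      case False
      have "R $$ (i, i) \<noteq> 0" if "i < a" for i
      proof -
        have "0 < cs * N (pick I i)" using Npos[of i] that less.prems cs by simp
        also have "\<dots> \<le> norm (R $$ (i, i))" using less that by auto
        finally show ?thesis by simp
      qed
      moreover have "cs * N (pick I a) \<le> vec_norm (col G a - v)"
        if "v \<in> vec_space.col_space n (keep_cols {..<a} G)" for v
      proof -
        have "v \<in> vec_space.col_space n (keep_cols {..<pick I a} F)"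
          using that col_space_keep_cols_mono[OF F I(1), of a] less.prems by (auto simp: G_def q_def)
        moreover have "pick I a \<noteq> 0"
          using False less.prems pick_mono_le[of a I 0] by (simp add: q_def del: pick.simps)
        ultimately show ?thesis
          using less.prems pos idx[of a] sines unfolding N_def
          by (subst col_G) (auto intro!: af_sine_le_dist[OF F])
      qed
      ultimately show ?thesis
        using dist_le_norm_QR_diag[OF G QR less.prems] by blast
    qed
  qed
  have Rnz: "R $$ (a, a) \<noteq> 0" if "a < q" for a
  proof -
    have "0 < cs * N (pick I a)" using Npos[OF that] cs by simp
    thus ?thesis using diag[OF that] by auto
  qed
  have cs_sq: "cs\<^sup>2 \<le> 1" using cs by (simp add: power_le_one)
  have t: "0 \<le> t" using cs cs_sq by (simp add: t_def ct_def)
  \<comment> \<open>Pythagoras in column \<open>a\<close>: as |r_aa| is at least cs times the column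
    norm, any entry above it is at most ct times that norm, which in turn is at most |r_aa| /
    cs.\<close>
  have off: "norm (R $$ (k, a)) \<le> t * norm (R $$ (a, a))" if ka: "k < a" "a < q" for k a
  proof -
    have "(norm (R $$ (k, a)))\<^sup>2 + (norm (R $$ (a, a)))\<^sup>2 = (\<Sum>i\<in>{k, a}. (norm (R $$ (i, a)))\<^sup>2)"
      using ka by simp
    also have "\<dots> \<le> (N (pick I a))\<^sup>2"
      unfolding N_sq[OF ka(2)] using ka by (intro sum_mono2) auto
    finally have "(norm (R $$ (k, a)))\<^sup>2 + (norm (R $$ (a, a)))\<^sup>2 \<le> (N (pick I a))\<^sup>2" .
    moreover have "(cs * N (pick I a))\<^sup>2 \<le> (norm (R $$ (a, a)))\<^sup>2"
      using diag[OF ka(2)] Npos[OF ka(2)] cs by (intro power_mono) auto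
    ultimately have "(norm (R $$ (k, a)))\<^sup>2 \<le> (1 - cs\<^sup>2) * (N (pick I a))\<^sup>2"
      by (simp add: power_mult_distrib algebra_simps)
    also have "\<dots> = (ct * N (pick I a))\<^sup>2"
      using cs_sq by (simp add: ct_def power_mult_distrib)
    finally have "norm (R $$ (k, a)) \<le> ct * N (pick I a)"
      by (rule power2_le_imp_le) (use cs_sq less_imp_le[OF Npos[OF ka(2)]] in \<open>simp add: ct_def\<close>)
    also have "\<dots> = t * (cs * N (pick I a))" using cs by (simp add: t_def)
    also have "\<dots> \<le> t * norm (R $$ (a, a))" using diag[OF ka(2)] t by (rule mult_left_mono)
    finally show ?thesis .
  qed
  have "0 \<notin> set (diag_mat R)" using R(1) Rnz by (auto simp: diag_mat_def)
  hence "det R \<noteq> 0" using upper_triangular_imp_det_eq_0_iff[OF R] by simp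
  then obtain S where S: "S \<in> carrier_mat q q" "S * R = 1\<^sub>m q" "R * S = 1\<^sub>m q"
    using det_non_zero_imp_unit[OF R(1), of "()"] by (auto simp: Units_def ring_mat_def)
  show "vec_space.rank n (keep_cols I F) = card I"
    using QR_full_rank[OF G QR S(1,2)] by (simp add: G_def q_def)

  \<comment> \<open>Bound for squared entries of \<open>S\<close>, indexed by original column
    numbers from 0; hence the \<open>Suc\<close> in \<open>lf_inv_diag\<close>, which counts from
    1.\<close>
  define W where "W i j = (lf_inv_diag cs F (Suc i) * inv_growth t (j - i))\<^sup>2" for i j
  have Wsum: "lf_b cs F (Suc j) = (\<Sum>i\<le>j. W i j)" for j
    using lf_b_eq[OF cs(1), of "Suc j" F]
    unfolding One_nat_def sum.atLeast1_atMost_eq lessThan_Suc_atMost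
    by (simp add: W_def t_def ct_def)
  have Sdiag: "norm (S $$ (a, a)) \<le> lf_inv_diag cs F (Suc (pick I a))" if a: "a < q" for a
  proof (cases "a = 0")
    case True
    thus ?thesis
      using a norm_left_inverse_diag[OF R Rnz S(1,2), of a] first pick_0[OF I(2)]
      by (simp add: lf_inv_diag_def col_norm_def N_def del: pick.simps)
  next
    case False
    hence "pick I a \<noteq> 0"
      using a pick_mono_le[of a I 0] by (simp add: q_def del: pick.simps)
    thus ?thesis
      using a norm_left_inverse_diag[OF R Rnz S(1,2), of a] diag[OF a] Npos[OF a] cs
      by (simp add: lf_inv_diag_def col_norm_def N_def frac_le del: pick.simps)
  qed
  have Sle: "(norm (S $$ (a, b)))\<^sup>2 \<le> W (pick I a) (pick I b)" if ab: "a \<le> b" "b < q" for a b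
    unfolding W_def
  proof (rule power_mono)
    have "norm (S $$ (a, b)) \<le> norm (S $$ (a, a)) * inv_growth t (b - a)"
      using R Rnz S(1,2) t off ab by (rule norm_left_inverse_le)
    also have "\<dots> \<le> lf_inv_diag cs F (Suc (pick I a)) * inv_growth t (pick I b - pick I a)"
    proof (rule mult_mono)
      \<comment> \<open>Removing columns only shortens the distance between two kept ones, and
        distance 0 arises only from distance 0, as \<open>inv_growth_mono\<close> demands.\<close>
      show "inv_growth t (b - a) \<le> inv_growth t (pick I b - pick I a)"
        using t pick_diff_ge[of a b I] ab
        by (intro inv_growth_mono) (auto simp: q_def dest: le_antisym simp del: pick.simps)
      show "0 \<le> lf_inv_diag cs F (Suc (pick I a))"
        using Sdiag[of a] ab norm_ge_zero[of "S $$ (a, a)"] by linarith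
    qed (use Sdiag ab t in \<open>auto intro: inv_growth_nonneg\<close>)
    finally show "norm (S $$ (a, b)) \<le> lf_inv_diag cs F (Suc (pick I a)) * inv_growth t (pick I b - pick I a)" .
  qed simp
  have inj: "inj_on (pick I) {..<q}"
    by (rule linorder_inj_onI) (auto simp: q_def dest: pick_mono_le)
  have "(frobenius_norm S)\<^sup>2 = (\<Sum>b<q. \<Sum>a<q. (norm (S $$ (a, b)))\<^sup>2)"
    unfolding frobenius_norm_sq using S(1) by (subst sum.swap) simp
  also have "\<dots> = (\<Sum>b<q. \<Sum>a\<le>b. (norm (S $$ (a, b)))\<^sup>2)"
    using left_inverse_upper_triangular[OF R Rnz S(1,2)]
    by (intro sum.cong refl sum.mono_neutral_right) auto
  also have "\<dots> \<le> (\<Sum>b<q. \<Sum>a\<le>b. W (pick I a) (pick I b))"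
    by (intro sum_mono Sle) auto
  also have "\<dots> \<le> (\<Sum>b<q. lf_b cs F (Suc (pick I b)))"
  proof (rule sum_mono)
    fix b assume b: "b \<in> {..<q}"
    have "(\<Sum>a\<le>b. W (pick I a) (pick I b)) = (\<Sum>i\<in>pick I ` {..b}. W i (pick I b))"
      using b by (subst sum.reindex) (auto intro: inj_on_subset[OF inj])
    \<comment> \<open>The terms of the removed columns, which are squares, are put back to complete
      \<open>lf_b\<close>.\<close>
    also have "\<dots> \<le> (\<Sum>i\<le>pick I b. W i (pick I b))"
    proof (rule sum_mono2)
      show "pick I ` {..b} \<subseteq> {..pick I b}"
        using b pick_mono_le[of b I] by (auto simp: q_def le_less simp del: pick.simps)
    qed (auto simp: W_def)
    finally show "(\<Sum>a\<le>b. W (pick I a) (pick I b)) \<le> lf_b cs F (Suc (pick I b))"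
      by (simp only: Wsum)
  qed
  also have "\<dots> = (\<Sum>j\<in>pick I ` {..<q}. lf_b cs F (Suc j))"
    by (simp add: sum.reindex[OF inj])
  also have "\<dots> \<le> (\<Sum>j<l. lf_b cs F (Suc j))"
    by (rule sum_mono2) (auto simp: Wsum W_def idx intro: sum_nonneg)
  finally have S_bound: "(frobenius_norm S)\<^sup>2 \<le> (\<Sum>j<l. lf_b cs F (Suc j))" .

  have "(frobenius_norm G)\<^sup>2 = (\<Sum>a<q. (N (pick I a))\<^sup>2)"
    unfolding frobenius_norm_sq_cols using G by (simp add: col_G N_def)
  also have "\<dots> = (\<Sum>j\<in>pick I ` {..<q}. (N j)\<^sup>2)"
    by (simp add: sum.reindex[OF inj])
  also have "\<dots> \<le> (\<Sum>j<l. (N j)\<^sup>2)"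
    by (rule sum_mono2) (auto simp: idx)
  finally have G_bound: "(frobenius_norm G)\<^sup>2 \<le> (\<Sum>j<l. (N j)\<^sup>2)" .

  have "(frobenius_cond G)\<^sup>2 = (frobenius_norm G)\<^sup>2 * (frobenius_norm S)\<^sup>2"
    unfolding frobenius_cond_def frobenius_norm_pseudoinverse_QR[OF G QR S]
    by (rule power_mult_distrib)
  also have "\<dots> \<le> (\<Sum>j<l. (N j)\<^sup>2) * (\<Sum>j<l. lf_b cs F (Suc j))"
    by (rule mult_mono[OF G_bound S_bound]) (auto intro: sum_nonneg)
  also have "\<dots> = lf_CF cs F l"
    by (simp add: lf_CF_def N_def col_norm_def sum.atLeast1_atMost_eq)
  finally show "(frobenius_cond (keep_cols I F))\<^sup>2 \<le> lf_CF cs F l" by (simp add: G_def)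
qed

section \<open>The two filters in succession\<close>

lemma lf_search_le: "lf_search cs \<kappa> F p \<le> p"
  by (induction p) auto

text \<open>Success at l = 1 stops the downward search before it can reach the default value
  0.\<close>

lemma lf_search_passes:
  assumes "lf_CF cs F 1 \<le> \<kappa>\<^sup>2" "1 \<le> p"
  shows "1 \<le> lf_search cs \<kappa> F p \<and> lf_CF cs F (lf_search cs \<kappa> F p) \<le> \<kappa>\<^sup>2"
  using assms(2)
proof (induction p)
  case (Suc p)
  thus ?case using assms(1) by (cases "p = 0") auto
qed simp

text \<open>\<open>F\<close>, \<open>F1\<close> and \<open>F2\<close> are the matrices before,
  between and after the filters. Besides the condition number, the conclusions record the facts
  about shape and columns that the induction over the run carries along.\<close>

lemma filters_cond:
  fixes F :: "'k::real_or_complex mat"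
  assumes F: "F \<in> carrier_mat n p" "1 \<le> p"
    and nz: "0\<^sub>v n \<notin> set (cols F)"
    and cs: "0 < cs" "cs < 1" and \<kappa>: "1 < \<kappa>"
    and LF: "(E1, F1, l) = length_filter cs \<kappa> E F p"
    and AF: "(E2, F2, q) = angle_filter cs E1 F1 l"
    and QR: "economy_QR F2 Q R"
  shows "F2 \<in> carrier_mat n q" "1 \<le> q" "q \<le> p" "set (cols F2) \<subseteq> set (cols F)"
    and "1 \<le> dim_col F1" "col F1 0 = col F 0" "col F2 0 = col F 0"
    and "vec_space.rank n F2 = q" "frobenius_cond F2 \<le> \<kappa>"
proof -
  have l_eq: "l = lf_search cs \<kappa> F p" and F1_eq: "F1 = keep_cols {..<l} F"
    using LF by (auto simp: length_filter_def Let_def)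
  have F_pos: "0 < vec_norm (col F i)" if "i < p" for i
  proof (rule vec_norm_pos)
    show "col F i \<in> carrier_vec n" using F that by auto
    show "col F i \<noteq> 0\<^sub>v n" using nz F that by (metis carrier_matD(2) cols_length cols_nth nth_mem)
  qed
  \<comment> \<open>For a single column the two factors are |f_1|^2 and 1 / |f_1|^2.\<close>
  have "lf_CF cs F 1 = 1"
    using F_pos[of 0] F(2) by (simp add: lf_CF_def lf_b_def col_norm_def)
  hence "lf_CF cs F 1 \<le> \<kappa>\<^sup>2" using \<kappa> by (simp add: one_le_power)
  from lf_search_passes[OF this F(2)] have l: "1 \<le> l" "lf_CF cs F l \<le> \<kappa>\<^sup>2" by (auto simp: l_eq)
  have l_le: "l \<le> p" unfolding l_eq by (rule lf_search_le)
  have F1: "F1 \<in> carrier_mat n l"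
    unfolding F1_eq using keep_cols_carrier[OF F(1), of "{..<l}"] l_le by auto
  thus "1 \<le> dim_col F1" using l by simp
  have col_F1: "col F1 i = col F i" if "i < l" for i
    unfolding F1_eq using that l_le F by (intro col_keep_initial_cols) auto
  show F1_0: "col F1 0 = col F 0" using l by (intro col_F1) simp

  \<comment> \<open>The kept columns numbered from 0. Removal concerns only numbers from 2 on in the
    count from 1, so index 0 always stays.\<close>
  define I where "I = {i. i < l \<and> i + 1 \<notin> {i \<in> {2..l}. af_sine F1 i < cs}}"
  have F2_eq: "F2 = keep_cols I F1" and q_eq: "q = card I"
    using AF by (simp_all add: angle_filter_def Let_def I_def)
  have I: "I \<subseteq> {..<l}" "0 \<in> I" using l by (auto simp: I_def)
  have I': "I \<subseteq> {..<dim_col F1}" using I F1 by auto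
  show F2: "F2 \<in> carrier_mat n q"
    unfolding F2_eq q_eq using F1 I(1) by (rule keep_cols_carrier)
  have "finite I" using I(1) finite_subset by blast
  thus q: "1 \<le> q" using I(2) unfolding q_eq by (metis card_gt_0_iff empty_iff less_eq_Suc_le One_nat_def)
  have "q \<le> l" unfolding q_eq using card_mono[OF _ I(1)] by simp
  thus "q \<le> p" using l_le by simp
  show "col F2 0 = col F 0"
    unfolding F1_0[symmetric] F2_eq using q I' pick_0[OF I(2)]
    by (subst col_keep_cols) (auto simp: q_eq simp del: pick.simps)
  show "set (cols F2) \<subseteq> set (cols F)"
    unfolding F2_eq F1_eq cols_keep_cols by (rule order_trans[OF set_nths_subset set_nths_subset])
  have F1_pos: "0 < vec_norm (col F1 i)" if "i < l" for i
    using F_pos that l_le by (simp add: col_F1)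
  have sines: "cs \<le> af_sine F1 (Suc i)" if "i \<in> I" "i \<noteq> 0" for i
    using that by (force simp: I_def)
  note cond = filtered_QR_cond[OF F1 I F1_pos cs sines QR[unfolded F2_eq]]
  show "vec_space.rank n F2 = q" unfolding F2_eq q_eq by (rule cond(1))
  have "(frobenius_cond F2)\<^sup>2 \<le> lf_CF cs F1 l" unfolding F2_eq by (rule cond(2))
  also have "\<dots> = lf_CF cs F l"
    unfolding F1_eq using l_le F(1) by (intro lf_CF_keep_initial_cols) auto
  also note l(2)
  finally show "frobenius_cond F2 \<le> \<kappa>" by (rule power2_le_imp_le) (use \<kappa> in simp)
qed

section \<open>Runs of the algorithm\<close>

lemma prepend_col_carrier: "A \<in> carrier_mat n p \<Longrightarrow> prepend_col v A \<in> carrier_mat n (Suc p)"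
  by (auto simp: prepend_col_def)

lemma cols_prepend_col:
  "A \<in> carrier_mat n p \<Longrightarrow> v \<in> carrier_vec n \<Longrightarrow> cols (prepend_col v A) = v # cols A"
  using cols_dim[of A] by (simp add: prepend_col_def)

lemma drop_last_col_carrier: "A \<in> carrier_mat n p \<Longrightarrow> drop_last_col A \<in> carrier_mat n (p - 1)"
  using keep_cols_carrier[of A n p "{..<p - 1}"] by (auto simp: drop_last_col_def)

lemma set_cols_drop_last_col: "set (cols (drop_last_col A)) \<subseteq> set (cols A)"
  by (simp add: drop_last_col_def cols_keep_cols set_nths_subset del: nths_upt_eq_take)

context
  fixes g :: "'k::real_or_complex vec \<Rightarrow> 'k vec" and x0 :: "'k vec" and \<beta> :: "nat \<Rightarrow> 'k"
    and cs \<kappa> :: real and n m N :: nat and T :: "'k faa_trace"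
  assumes g: "g \<in> carrier_vec n \<rightarrow> carrier_vec n"
    and cs: "0 < cs" "cs < 1" and \<kappa>: "\<kappa> > 1" and m: "m \<ge> 1"
    and x0: "x0 \<in> carrier_vec n"
    and run: "faa_run n g cs \<kappa> m x0 \<beta> N T"
    and diff: "\<forall>j \<in> {1..N}. resid T (j + 1) - resid T j \<noteq> 0\<^sub>v n"
begin

lemma resid_carrier: "j \<le> N \<Longrightarrow> iterate T j \<in> carrier_vec n \<Longrightarrow> resid T (Suc j) \<in> carrier_vec n"
  using run funcset_mem[OF g, of "iterate T j"] by (simp add: faa_run_def minus_carrier_vec)

text \<open>The iterates x_k and x_(k+1) determine the residuals w_(k+1) and w_(k+2), whose
  difference is the new column of the next step.\<close>

definition faa_invariant :: "nat \<Rightarrow> bool" where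
  "faa_invariant k \<longleftrightarrow> F_out T k \<in> carrier_mat n (m_out T k) \<and> m_out T k \<in> {1..m}
     \<and> 0\<^sub>v n \<notin> set (cols (F_out T k))
     \<and> iterate T k \<in> carrier_vec n \<and> iterate T (Suc k) \<in> carrier_vec n"

lemma faa_invariant_1:
  assumes "1 \<le> N"
  shows "faa_invariant 1"
proof -
  have init: "faa_init n x0 \<beta> T" using run by (simp add: faa_run_def)
  have r1: "resid T 1 \<in> carrier_vec n"
    using resid_carrier[of 0] init x0 by (simp add: faa_init_def)
  hence x1: "iterate T 1 \<in> carrier_vec n" using init x0 by (simp add: faa_init_def)
  hence r2: "resid T 2 \<in> carrier_vec n"
    using resid_carrier[of 1] assms by (simp add: numeral_2_eq_2)
  have F: "F_out T 1 = mat_of_cols n [resid T 2 - resid T 1]" using init by (simp add: faa_init_def)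
  have "iterate T 2 \<in> carrier_vec n"
    using init x1 r2 F by (intro carrier_vecI) (simp add: faa_init_def)
  moreover have "cols (F_out T 1) = [resid T 2 - resid T 1]"
    unfolding F using r1 r2 by simp
  moreover have "resid T 2 - resid T 1 \<noteq> 0\<^sub>v n"
    using diff assms by (auto dest!: bspec[of _ _ 1] simp: numeral_2_eq_2)
  moreover have "m_out T 1 = 1" using init by (simp add: faa_init_def)
  ultimately show ?thesis
    using x1 m F by (auto simp: faa_invariant_def numeral_2_eq_2 intro: carrier_matI)
qed

lemma faa_F_new:
  assumes inv: "faa_invariant (k - 1)" and k: "2 \<le> k" "k \<le> N"
  shows "F_new T k \<in> carrier_mat n (m_new T k)" "m_new T k \<in> {1..m}"
    "0\<^sub>v n \<notin> set (cols (F_new T k))" "col (F_new T k) 0 = resid T (k + 1) - resid T k"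
proof -
  have step: "faa_step cs \<kappa> m \<beta> T k" using run k by (simp add: faa_run_def)
  have k': "Suc (k - 1) = k" using k by simp
  have F: "F_out T (k - 1) \<in> carrier_mat n (m_out T (k - 1))" "m_out T (k - 1) \<in> {1..m}"
      "0\<^sub>v n \<notin> set (cols (F_out T (k - 1)))"
    and x: "iterate T (k - 1) \<in> carrier_vec n" "iterate T k \<in> carrier_vec n"
    using inv k' by (auto simp: faa_invariant_def)
  have r: "resid T k \<in> carrier_vec n" "resid T (k + 1) \<in> carrier_vec n"
    using resid_carrier[of "k - 1"] resid_carrier[of k] x k k' by auto
  define A where "A = (if m_out T (k - 1) = m then drop_last_col else id) (F_out T (k - 1))"
  have m_new: "m_new T k = min (m_out T (k - 1) + 1) m"
    and F_new: "F_new T k = prepend_col (resid T (k + 1) - resid T k) A"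
    using step by (simp_all add: faa_step_def Let_def A_def)
  show "m_new T k \<in> {1..m}" using m by (auto simp: m_new)
  \<comment> \<open>In both cases \<open>A\<close> is one column short of \<open>m_new\<close>: at
    full depth the dropped column makes room, otherwise the depth grows by one.\<close>
  have A: "A \<in> carrier_mat n (m_new T k - 1)"
    using F drop_last_col_carrier[OF F(1)] m by (auto simp: A_def m_new)
  show "F_new T k \<in> carrier_mat n (m_new T k)"
    using prepend_col_carrier[OF A] m by (simp add: F_new m_new)
  have cols: "cols (F_new T k) = (resid T (k + 1) - resid T k) # cols A"
    unfolding F_new using r by (intro cols_prepend_col[OF A]) auto
  have "set (cols A) \<subseteq> set (cols (F_out T (k - 1)))"
    using set_cols_drop_last_col by (auto simp: A_def)
  moreover have "resid T (k + 1) - resid T k \<noteq> 0\<^sub>v n" using diff k by auto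
  ultimately show "0\<^sub>v n \<notin> set (cols (F_new T k))" using F(3) by (auto simp: cols)
  have "0 < dim_col (F_new T k)" using cols by (metis cols_length length_greater_0_conv list.discI)
  thus "col (F_new T k) 0 = resid T (k + 1) - resid T k"
    using cols cols_nth[of 0 "F_new T k"] by simp
qed

text \<open>Serves twice: the first three conclusions carry the invariant from k - 1 to k, the
  others are the claims about iteration k.\<close>

lemma faa_step_filters:
  assumes inv: "faa_invariant (k - 1)" and k: "2 \<le> k" "k \<le> N"
  shows "F_out T k \<in> carrier_mat n (m_out T k)" "m_out T k \<in> {1..m}"
    "0\<^sub>v n \<notin> set (cols (F_out T k))"
    "dim_col (F_len T k) \<ge> 1" "col (F_len T k) 0 = resid T (k + 1) - resid T k"
    "col (F_out T k) 0 = resid T (k + 1) - resid T k"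
    "vec_space.rank n (F_out T k) = m_out T k" "frobenius_cond (F_out T k) \<le> \<kappa>"
proof -
  note new = faa_F_new[OF assms]
  have step: "faa_step cs \<kappa> m \<beta> T k" using run k by (simp add: faa_run_def)
  hence LF: "(E_len T k, F_len T k, m_len T k) = length_filter cs \<kappa> (E_new T k) (F_new T k) (m_new T k)"
    and AF: "(E_out T k, F_out T k, m_out T k) = angle_filter cs (E_len T k) (F_len T k) (m_len T k)"
    and QR: "economy_QR (F_out T k) (Q_out T k) (R_out T k)"
    by (simp_all add: faa_step_def)
  have "1 \<le> m_new T k" using new(2) by simp
  note * = filters_cond[OF new(1) this new(3) cs \<kappa> LF AF QR]
  show "F_out T k \<in> carrier_mat n (m_out T k)" "dim_col (F_len T k) \<ge> 1"
    "vec_space.rank n (F_out T k) = m_out T k" "frobenius_cond (F_out T k) \<le> \<kappa>"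
    by (fact *)+
  show "m_out T k \<in> {1..m}" "0\<^sub>v n \<notin> set (cols (F_out T k))"
    "col (F_len T k) 0 = resid T (k + 1) - resid T k"
    "col (F_out T k) 0 = resid T (k + 1) - resid T k"
    using *(2,3,4,6,7) new by auto
qed

lemma faa_invariant: "1 \<le> k \<Longrightarrow> k \<le> N \<Longrightarrow> faa_invariant k"
proof (induction k)
  case (Suc k)
  show ?case
  proof (cases "k = 0")
    case True
    thus ?thesis using Suc.prems faa_invariant_1 by simp
  next
    case False
    hence inv: "faa_invariant k" using Suc by simp
    note out = faa_step_filters[of "Suc k", unfolded diff_Suc_1, OF inv]
    have "faa_step cs \<kappa> m \<beta> T (Suc k)" using run Suc.prems False by (simp add: faa_run_def)
    hence x: "iterate T (Suc (Suc k)) = iterate T (Suc k) + \<beta> (Suc k) \<cdot>\<^sub>v resid T (Suc (Suc k))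
        - (E_out T (Suc k) + \<beta> (Suc k) \<cdot>\<^sub>m F_out T (Suc k)) *\<^sub>v coeff T (Suc (Suc k))"
      by (simp add: faa_step_def)
    \<comment> \<open>A sum or difference of vectors or matrices takes its dimensions from the
      second operand, so the row count of \<open>F_out\<close> fixes the dimension of the new
      iterate.\<close>
    have "dim_row (F_out T (Suc k)) = n" using out(1) Suc.prems False by simp
    hence "iterate T (Suc (Suc k)) \<in> carrier_vec n" by (intro carrier_vecI) (simp add: x)
    thus ?thesis
      using out(1-3) inv Suc.prems False by (simp add: faa_invariant_def)
  qed
qed simp

end

theorem theorem3p1:
  fixes g :: "'k::real_or_complex vec \<Rightarrow> 'k vec"
    and x0 :: "'k vec" and \<beta> :: "nat \<Rightarrow> 'k"
    and cs \<kappa> :: real and n m N k :: nat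
    and T :: "'k faa_trace"
  assumes "g \<in> carrier_vec n \<rightarrow> carrier_vec n"
    and "0 < cs" and "cs < 1" and "\<kappa> > 1" and "m \<ge> 1" and "n \<ge> m"
    and "x0 \<in> carrier_vec n"
    and "faa_run n g cs \<kappa> m x0 \<beta> N T"
    and "\<forall>j \<in> {1..N}. resid T (j + 1) - resid T j \<noteq> 0\<^sub>v n"
    and "2 \<le> k" and "k \<le> N"
  shows "(vec_space.rank n (F_out T k) = dim_col (F_out T k)
          \<and> frobenius_cond (F_out T k) \<le> \<kappa>
          \<and> spectral_cond (F_out T k) \<le> \<kappa>)
       \<and> (dim_col (F_len T k) \<ge> 1 \<and> col (F_len T k) 0 = resid T (k + 1) - resid T k)
       \<and> (dim_col (F_out T k) \<ge> 1 \<and> col (F_out T k) 0 = resid T (k + 1) - resid T k)"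
proof -
  note run = assms(1-5,7-9)
  have "faa_invariant n m T (k - 1)"
    using assms(10,11) by (intro faa_invariant[OF run]) auto
  note out = faa_step_filters[OF run this assms(10,11)]
  have "dim_col (F_out T k) = m_out T k" using out(1) by simp
  moreover have "spectral_cond (F_out T k) \<le> \<kappa>"
    using spectral_cond_le_frobenius_cond out(8) by (rule order_trans)
  ultimately show ?thesis using out by simp
qed

end
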